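(* Let $X$ be a Banach space and let $\Gamma:[0,1]\to cwk(X)$ be any Birkhoff integrable multifunction. Then there exists at least one Birkhoff integrable selection of $\Gamma$.
   Context: $[0,1]$ carries Lebesgue measure; $\mathcal{L}$ is the family of Lebesgue measurable subsets of $[0,1]$; $|\cdot|$ denotes Lebesgue measure. $cwk(X)$ is the family of all non-empty convex weakly compact subsets of $X$, with Minkowski addition, multiplication by scalars, and the Hausdorff distance $d_H$. A function $f:[0,1]\to X$ is a selection of $\Gamma$ if $f(t)\in\Gamma(t)$ for every $t\in[0,1]$. $\Gamma:[0,1]\to cwk(X)$ is Birkhoff integrable if there is a set $\Phi\in cwk(X)$ such that for every $\varepsilon>0$ there is a countable partition $\Pi_0$ of $[0,1]$ into sets of $\mathcal{L}$ such that for every countable partition $\Pi=(A_n)_n$ of $[0,1]$ in $\mathcal{L}$ finer than $\Pi_0$ and any choice of points $t_n\in A_n$, the series $\sum_n|A_n|\Gamma(t_n)$ is unconditionally convergent (in $d_H$) and $d_H(\Phi,\sum_n|A_n|\Gamma(t_n))<\varepsilon$. A function $g:[0,1]\to X$ is Birkhoff integrable if the same condition holds with $g$ identified with $t\mapsto\{g(t)\}$ and $\Phi$ a single vector of $X$. Equivalently: there is $y\in X$ such that for each $\varepsilon>0$ there is a measurable gauge $\delta:[0,1]\to(0,\infty)$ such that $\|\sum_{j}|I_j|g(t_j)-y\|\le\varepsilon$ for every finite collection $\{(I_j,t_j)\}$ of non-overlapping closed intervals $I_j$ with union $[0,1]$ and points $t_j\in[0,1]$ with $I_j\subset(t_j-\delta(t_j),t_j+\delta(t_j))$.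 *)

theory Defs
  imports "HOL-Analysis.Analysis" "HOL-Library.Set_Algebras" "HOL-Library.Disjoint_Sets"
begin

definition weak_topology :: "'a::real_normed_vector topology" where
  "weak_topology =
     topology_generated_by {f -` U | (f :: 'a \<Rightarrow> real) U. bounded_linear f \<and> open U}"

definition cwk :: "'a::real_normed_vector set set" where
  "cwk = {K. K \<noteq> {} \<and> convex K \<and> compactin weak_topology K}"

(* The suprema are meaningful for non-empty norm-bounded sets; every member of cwk is one. *)
definition hausdorff_dist :: "'a::metric_space set \<Rightarrow> 'a set \<Rightarrow> real" where
  "hausdorff_dist A B = max (SUP a\<in>A. infdist a B) (SUP b\<in>B. infdist b A)"

(* Unconditional convergence is expressed, as in has_sum, by the net of finite partial sums.
   Sums of sets are Minkowski sums (Set_Algebras), the empty sum being {0}. *)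
definition has_set_sum ::
    "('i \<Rightarrow> 'a::real_normed_vector set) \<Rightarrow> 'a set \<Rightarrow> 'i set \<Rightarrow> bool" where
  "has_set_sum B S I \<longleftrightarrow> S \<in> cwk \<and>
     ((\<lambda>F. hausdorff_dist (\<Sum>i\<in>F. B i) S) \<longlongrightarrow> 0) (finite_subsets_at_top I)"

(* The members of a partition are non-empty (partition_on), so each of them contains a
   possible choice of tag. *)
definition countable_measurable_partition :: "real set set \<Rightarrow> bool" where
  "countable_measurable_partition P \<longleftrightarrow>
     partition_on {0..1} P \<and> countable P \<and> P \<subseteq> sets (lebesgue_on {0..1})"

(* Only the values of Gamma on [0,1] matter: the tags lie in members of a partition of [0,1]. *)
definition has_Birkhoff_integral ::
    "(real \<Rightarrow> 'a::real_normed_vector set) \<Rightarrow> 'a set \<Rightarrow> bool" where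
  "has_Birkhoff_integral \<Gamma> \<Phi> \<longleftrightarrow>
     (\<forall>\<epsilon>>0. \<exists>P0. countable_measurable_partition P0 \<and>
        (\<forall>P. countable_measurable_partition P \<and> refines {0..1} P P0 \<longrightarrow>
           (\<forall>t. (\<forall>A\<in>P. t A \<in> A) \<longrightarrow>
              (\<exists>S. has_set_sum (\<lambda>A. (\<lambda>x. measure lebesgue A *\<^sub>R x) ` \<Gamma> (t A)) S P \<and>
                   hausdorff_dist \<Phi> S < \<epsilon>))))"

definition Birkhoff_integrable_multifunction ::
    "(real \<Rightarrow> 'a::real_normed_vector set) \<Rightarrow> bool" where
  "Birkhoff_integrable_multifunction \<Gamma> \<longleftrightarrow>
     (\<forall>t\<in>{0..1}. \<Gamma> t \<in> cwk) \<and> (\<exists>\<Phi>\<in>cwk. has_Birkhoff_integral \<Gamma> \<Phi>)"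

definition Birkhoff_integrable :: "(real \<Rightarrow> 'a::real_normed_vector) \<Rightarrow> bool" where
  "Birkhoff_integrable g \<longleftrightarrow> (\<exists>y. has_Birkhoff_integral (\<lambda>t. {g t}) {y})"

definition is_selection :: "(real \<Rightarrow> 'a) \<Rightarrow> (real \<Rightarrow> 'a set) \<Rightarrow> bool" where
  "is_selection f \<Gamma> \<longleftrightarrow> (\<forall>t\<in>{0..1}. f t \<in> \<Gamma> t)"

end

theory Submission
  imports Defs
begin

text \<open>
  Let \<open>\<Phi>\<close> be the integral of \<open>\<Gamma>\<close>. Being weakly compact, \<open>\<Phi>\<close> has a strongly exposed
  point: some \<open>x0\<close> in \<open>\<Phi>\<close> and some functional \<open>f\<close> that attains its maximum over \<open>\<Phi>\<close> at \<open>x0\<close>, such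
  that points of \<open>\<Phi>\<close> at which \<open>f\<close> is almost maximal are close to \<open>x0\<close> in norm. Let \<open>g t\<close> be a
  point of \<open>\<Gamma> t\<close> at which \<open>f\<close> is maximal. A Birkhoff sum \<open>y\<close> of \<open>g\<close> is a selection from the
  corresponding sum \<open>S\<close> of \<open>\<Gamma>\<close>, hence lies close to \<open>\<Phi>\<close>; and it maximizes \<open>f\<close> over \<open>S\<close>, so \<open>f y\<close>
  is almost the maximum \<open>f x0\<close> of \<open>f\<close> over \<open>\<Phi>\<close>. Strong exposure turns this information into norm
  closeness of \<open>y\<close> to \<open>x0\<close>, and \<open>x0\<close> is the integral of \<open>g\<close>
  (\<open>selection_sum_near_set_sum\<close>, \<open>maximizing_selection_sum_maximal\<close>). The sums of \<open>g\<close> converge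
  unconditionally because in Minkowski sums of bounded sets a common summand can be cancelled: if
  \<open>A + C\<close> stays within \<open>r\<close> of \<open>A\<close>, then all of \<open>C\<close> has norm at most \<open>r\<close>
  (\<open>summand_small_if_sum_near\<close>).

  The bulk of the work is the existence of a strongly exposed point, a theorem of Lindenstrauss and
  Troyanski. The proof here is a Baire category argument in the dual space: the functionals that
  determine a slice of \<open>\<Phi>\<close> of diameter at most \<open>e\<close> form an open set, which is dense, and a functional
  in the intersection over \<open>e = 1, 1/2, 1/3, \<dots>\<close> strongly exposes a point. Density has three
  ingredients. A weakly compact set has a non-empty relatively weakly open subset of small diameter
  (\<open>weakly_compact_fragmented\<close>); otherwise a binary tree of open sets would yield uncountably many
  points of a separable set at mutual distance at least \<open>e\<close>. Applied to a minimal subset of \<open>K\<close> that still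
  determines \<open>K\<close> relative to a convex set \<open>D\<close>, and combined with the Bourgain-Namioka superlemma,
  this gives a small slice of \<open>K\<close> whose functional separates it from \<open>D\<close>
  (\<open>small_slice_away_from_convex\<close>). Finally, choosing for \<open>D\<close> a large flat disc below the graph of
  a given functional \<open>f\<close> over \<open>K\<close> forces the separating functional to be a multiple of a small
  perturbation of \<open>f\<close> (\<open>small_slice_dense\<close>).
\<close>

section \<open>Separation by continuous linear functionals\<close>

definition sublinear :: "('a::real_vector \<Rightarrow> real) \<Rightarrow> bool" where
  "sublinear p \<longleftrightarrow> (\<forall>x y. p (x + y) \<le> p x + p y) \<and> (\<forall>t>0. \<forall>x. p (t *\<^sub>R x) \<le> t * p x)"

lemma sublinear_add: "sublinear p \<Longrightarrow> p (x + y) \<le> p x + p y"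
  and sublinear_scale_le: "sublinear p \<Longrightarrow> t > 0 \<Longrightarrow> p (t *\<^sub>R x) \<le> t * p x"
  by (auto simp: sublinear_def)

lemma sublinear_scale:
  assumes "sublinear p" "t > 0"
  shows "p (t *\<^sub>R x) = t * p x"
proof -
  have "p ((1/t) *\<^sub>R (t *\<^sub>R x)) \<le> (1/t) * p (t *\<^sub>R x)"
    using assms by (intro sublinear_scale_le) auto
  then have "t * p x \<le> p (t *\<^sub>R x)"
    using assms by (simp add: field_simps)
  with sublinear_scale_le[OF assms, of x] show ?thesis by simp
qed

lemma sublinear_zero: "sublinear p \<Longrightarrow> p 0 = 0"
  using sublinear_scale[of p 2 0] by simp

lemma sublinear_minus: "sublinear p \<Longrightarrow> - p (- x) \<le> p x"
  using sublinear_add[of p x "- x"] sublinear_zero[of p] by simp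

text \<open>
  The common source of every extension argument below: the infimal convolution of \<open>p\<close> with a
  convex cone of prescribed pairs (vector, lower bound) is again sublinear, and any linear functional
  below it takes at least the value \<open>r\<close> at \<open>w\<close> for every pair \<open>(w, r)\<close> of the cone.
\<close>

lemma sublinear_minorant_by_cone:
  fixes p :: "'a::real_vector \<Rightarrow> real" and I :: "('a \<times> real) set"
  assumes p: "sublinear p"
    and zero: "(0, 0) \<in> I"
    and add: "\<And>v w. v \<in> I \<Longrightarrow> w \<in> I \<Longrightarrow> v + w \<in> I"
    and scale: "\<And>t w. t > 0 \<Longrightarrow> w \<in> I \<Longrightarrow> t *\<^sub>R w \<in> I"
    and below: "\<And>w r. (w, r) \<in> I \<Longrightarrow> r \<le> p w"
  obtains q where "sublinear q" "\<And>x. q x \<le> p x" "\<And>w r. (w, r) \<in> I \<Longrightarrow> q (- w) \<le> - r"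
proof -
  define q where "q z = (INF w\<in>I. p (z + fst w) - snd w)" for z
  have ne: "I \<noteq> {}" using zero by auto
  have bdd: "bdd_below ((\<lambda>w. p (z + fst w) - snd w) ` I)" for z
  proof (rule bdd_belowI2[where m = "- p (- z)"])
    fix w assume "w \<in> I"
    then have "snd w \<le> p (fst w)" using below[of "fst w" "snd w"] by simp
    moreover have "p (fst w) \<le> p (- z) + p (z + fst w)"
      using sublinear_add[OF p, of "- z" "z + fst w"] by simp
    ultimately show "- p (- z) \<le> p (z + fst w) - snd w" by simp
  qed
  have le: "q z \<le> p (z + w) - r" if "(w, r) \<in> I" for z w r
    using cINF_lower[OF bdd that, of z] by (simp add: q_def)
  show ?thesis
  proof
    show "sublinear q"
      unfolding sublinear_def
    proof (intro conjI allI impI)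
      fix x y
      have 1: "q (x + y) - (p (y + fst w) - snd w) \<le> p (x + fst v) - snd v"
        if "v \<in> I" "w \<in> I" for v w
      proof -
        have "q (x + y) \<le> p ((x + y) + (fst v + fst w)) - (snd v + snd w)"
          using add[OF that] by (intro le) (simp add: plus_prod_def)
        also have "p ((x + y) + (fst v + fst w)) \<le> p (x + fst v) + p (y + fst w)"
          using sublinear_add[OF p, of "x + fst v" "y + fst w"] by (simp add: algebra_simps)
        finally show ?thesis by simp
      qed
      have "q (x + y) - (p (y + fst w) - snd w) \<le> q x" if "w \<in> I" for w
        unfolding q_def[of x] by (rule cINF_greatest[OF ne]) (use 1 that in auto)
      then have "q (x + y) - q x \<le> q y"
        unfolding q_def[of y] by (intro cINF_greatest[OF ne]) (simp add: algebra_simps)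
      then show "q (x + y) \<le> q x + q y" by simp
    next
      fix t :: real and x assume t: "t > 0"
      have "q (t *\<^sub>R x) / t \<le> p (x + fst w) - snd w" if "w \<in> I" for w
      proof -
        have "q (t *\<^sub>R x) \<le> p (t *\<^sub>R x + t *\<^sub>R fst w) - t * snd w"
          using scale[OF t that] by (intro le) (simp add: scaleR_prod_def)
        also have "p (t *\<^sub>R x + t *\<^sub>R fst w) = t * p (x + fst w)"
          using sublinear_scale[OF p t, of "x + fst w"] by (simp add: scaleR_add_right)
        finally show ?thesis using t by (simp add: field_simps)
      qed
      then have "q (t *\<^sub>R x) / t \<le> q x"
        unfolding q_def[of x] by (intro cINF_greatest[OF ne])
      then show "q (t *\<^sub>R x) \<le> t * q x" using t by (simp add: field_simps)
    qed
    show "q x \<le> p x" for x using le[OF zero, of x] by simp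
    show "q (- w) \<le> - r" if "(w, r) \<in> I" for w r
      using le[OF that, of "- w"] sublinear_zero[OF p] by simp
  qed
qed

text \<open>
  The Hahn-Banach theorem. By Zorn's lemma there is a minimal sublinear functional \<open>f\<close> below \<open>p\<close>.
  Lowering \<open>f\<close> by the ray through \<open>(y, f y)\<close> cannot change it, so that \<open>f (- y) = - f y\<close>; an odd
  sublinear functional is linear.
\<close>

lemma sublinear_dominates_linear:
  fixes p :: "'a::real_vector \<Rightarrow> real"
  assumes "sublinear p"
  obtains f where "linear f" "\<And>x. f x \<le> p x"
proof -
  define A where "A = {q. sublinear q \<and> (\<forall>x. q x \<le> p x)}"
  define P where "P = (\<lambda>q r :: 'a \<Rightarrow> real. \<forall>x. r x \<le> q x)"
  have "\<exists>m\<in>A. \<forall>a\<in>A. P m a \<longrightarrow> a = m"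
  proof (rule predicate_Zorn)
    show "partial_order_on A (relation_of P A)"
      unfolding partial_order_on_def preorder_on_def refl_on_def trans_def antisym_def relation_of_def P_def
      by (auto intro: order_trans) (meson ext order_antisym)
  next
    fix C assume C: "C \<in> Chains (relation_of P A)"
    then have CA: "C \<subseteq> A" unfolding Chains_def relation_of_def by blast
    have ch: "P q r \<or> P r q" if "q \<in> C" "r \<in> C" for q r
      using C that unfolding Chains_def relation_of_def by blast
    show "\<exists>u\<in>A. \<forall>a\<in>C. P a u"
    proof (cases "C = {}")
      case True
      then show ?thesis using assms by (auto simp: A_def)
    next
      case ne: False
      define u where "u x = (INF q\<in>C. q x)" for x
      have bdd: "bdd_below ((\<lambda>q. q x) ` C)" for x
      proof (rule bdd_belowI2[where m = "- p (- x)"])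
        fix q assume "q \<in> C"
        then have "sublinear q" "q (- x) \<le> p (- x)" using CA by (auto simp: A_def)
        then show "- p (- x) \<le> q x" using sublinear_minus[of q x] by linarith
      qed
      have le: "u x \<le> q x" if "q \<in> C" for q x
        unfolding u_def by (rule cINF_lower[OF bdd that])
      have "sublinear u"
        unfolding sublinear_def
      proof (intro conjI allI impI)
        fix x y
        have 1: "u (x + y) - r y \<le> q x" if qr: "q \<in> C" "r \<in> C" for q r
        proof -
          obtain s where s: "s \<in> C" "P q s" "P r s"
            using ch[OF qr] qr by (metis P_def order_refl)
          have "u (x + y) \<le> s (x + y)" using le s by blast
          also have "\<dots> \<le> s x + s y" using s CA sublinear_add by (fastforce simp: A_def)
          also have "\<dots> \<le> q x + r y" using s by (auto simp: P_def intro!: add_mono)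
          finally show ?thesis by simp
        qed
        have "u (x + y) - r y \<le> u x" if "r \<in> C" for r
          unfolding u_def[of x] by (rule cINF_greatest[OF ne]) (use 1 that in auto)
        then have "u (x + y) - u x \<le> u y"
          unfolding u_def[of y] by (intro cINF_greatest[OF ne]) (simp add: algebra_simps)
        then show "u (x + y) \<le> u x + u y" by simp
      next
        fix t :: real and x assume t: "t > 0"
        have "u (t *\<^sub>R x) / t \<le> q x" if "q \<in> C" for q
        proof -
          have "u (t *\<^sub>R x) \<le> q (t *\<^sub>R x)" using le that by blast
          also have "\<dots> \<le> t * q x" using that CA t sublinear_scale_le by (fastforce simp: A_def)
          finally show ?thesis using t by (simp add: field_simps)
        qed
        then have "u (t *\<^sub>R x) / t \<le> u x"
          unfolding u_def[of x] by (intro cINF_greatest[OF ne])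
        then show "u (t *\<^sub>R x) \<le> t * u x" using t by (simp add: field_simps)
      qed
      moreover have "u x \<le> p x" for x
      proof -
        obtain q where "q \<in> C" using ne by auto
        then have "q x \<le> p x" using CA by (auto simp: A_def)
        then show ?thesis using le[OF \<open>q \<in> C\<close>, of x] by linarith
      qed
      ultimately show ?thesis using le by (auto simp: A_def P_def)
    qed
  qed
  then obtain f where f: "f \<in> A" and min: "\<And>a. a \<in> A \<Longrightarrow> P f a \<Longrightarrow> a = f" by blast
  have fs: "sublinear f" and fp: "\<And>x. f x \<le> p x" using f by (auto simp: A_def)
  have neg: "f (- y) \<le> - f y" for y
  proof -
    obtain q where q: "sublinear q" "\<And>x. q x \<le> f x"
      "\<And>w r. (w, r) \<in> {(t *\<^sub>R y, t * f y) | t. t \<ge> 0} \<Longrightarrow> q (- w) \<le> - r"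
    proof (rule sublinear_minorant_by_cone[OF fs, where I = "{(t *\<^sub>R y, t * f y) | t. t \<ge> 0}"], goal_cases)
      case 1
      show ?case by force
    next
      case (2 v w)
      then obtain s t where "s \<ge> 0" "t \<ge> 0" "v = (s *\<^sub>R y, s * f y)" "w = (t *\<^sub>R y, t * f y)" by auto
      then show ?case by (auto intro!: exI[of _ "s + t"] simp: algebra_simps)
    next
      case (3 s w)
      then obtain t where "t \<ge> 0" "w = (t *\<^sub>R y, t * f y)" by auto
      then show ?case using 3 by (auto intro!: exI[of _ "s * t"])
    next
      case (4 w r)
      then obtain t where t: "t \<ge> 0" "w = t *\<^sub>R y" "r = t * f y" by auto
      then show ?case
        using sublinear_scale[OF fs, of t y] sublinear_zero[OF fs] by (cases "t = 0") auto
    next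
      case (5 q)
      then show ?case by blast
    qed
    have "q = f" using q(1,2) fp by (intro min) (auto simp: A_def P_def intro: order_trans)
    moreover have "(y, f y) \<in> {(t *\<^sub>R y, t * f y) | t. t \<ge> 0}" by (force intro: exI[of _ 1])
    ultimately show ?thesis using q(3) by blast
  qed
  then have neg': "f (- y) = - f y" for y using sublinear_minus[OF fs, of y] neg[of y] by linarith
  have "linear f"
  proof (rule linearI)
    show "f (x + y) = f x + f y" for x y
      using sublinear_add[OF fs, of x y] sublinear_add[OF fs, of "- x" "- y"] neg'[of "x + y"]
        neg'[of x] neg'[of y] by simp
    show "f (t *\<^sub>R x) = t *\<^sub>R f x" for t x
    proof (cases t "0 :: real" rule: linorder_cases)
      case less
      then have "f ((- t) *\<^sub>R x) = (- t) * f x" by (intro sublinear_scale[OF fs]) auto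
      then show ?thesis using neg'[of "t *\<^sub>R x"] by simp
    qed (use sublinear_zero[OF fs] sublinear_scale[OF fs] in auto)
  qed
  then show ?thesis using fp that by blast
qed

text \<open>
  The norm is lowered by the cone that \<open>C - x\<close> generates, the value \<open>d\<close> being prescribed on
  \<open>C - x\<close>. The distance assumption says precisely that these values lie below the norm.
\<close>

lemma functional_separating_from_convex:
  fixes C :: "'a::real_normed_vector set"
  assumes "convex C" and d: "\<And>c. c \<in> C \<Longrightarrow> d \<le> norm (c - x)"
  obtains f :: "'a \<Rightarrow>\<^sub>L real"
  where "\<And>z. \<bar>blinfun_apply f z\<bar> \<le> norm z" "\<And>c. c \<in> C \<Longrightarrow> blinfun_apply f x + d \<le> blinfun_apply f c"
proof -
  have sn: "sublinear (norm :: 'a \<Rightarrow> real)" by (auto simp: sublinear_def norm_triangle_ineq)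
  define I where "I = insert (0, 0) {(t *\<^sub>R (c - x), t * d) | t c. t > 0 \<and> c \<in> C}"
  obtain q where q: "sublinear q" "\<And>z. q z \<le> norm z" "\<And>w r. (w, r) \<in> I \<Longrightarrow> q (- w) \<le> - r"
  proof (rule sublinear_minorant_by_cone[OF sn, where I = I], goal_cases)
    case 1
    show ?case by (simp add: I_def)
  next
    case (2 v w)
    show ?case
    proof (cases "v = (0, 0) \<or> w = (0, 0)")
      case True
      then show ?thesis using 2 by (metis add_0 add_0_right zero_prod_def)
    next
      case False
      then obtain s a t b where st: "s > 0" "t > 0" "a \<in> C" "b \<in> C"
        "v = (s *\<^sub>R (a - x), s * d)" "w = (t *\<^sub>R (b - x), t * d)"
        using 2 by (auto simp: I_def)
      define c where "c = (s / (s + t)) *\<^sub>R a + (t / (s + t)) *\<^sub>R b"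
      have "c \<in> C" unfolding c_def using st
        by (intro convexD[OF \<open>convex C\<close>]) (auto simp: add_divide_distrib[symmetric])
      moreover have "(s + t) *\<^sub>R c = s *\<^sub>R a + t *\<^sub>R b"
        using st by (simp add: c_def scaleR_add_right)
      then have "v + w = ((s + t) *\<^sub>R (c - x), (s + t) * d)"
        using st by (simp add: algebra_simps)
      ultimately show ?thesis using st by (auto simp: I_def intro!: exI[of _ "s + t"] exI[of _ c])
    qed
  next
    case (3 s w)
    show ?case
    proof (cases "w = (0, 0)")
      case True
      then show ?thesis by (simp add: I_def)
    next
      case False
      then obtain t c where "t > 0" "c \<in> C" "w = (t *\<^sub>R (c - x), t * d)" using 3 by (auto simp: I_def)
      then show ?thesis using 3 by (auto simp: I_def intro!: exI[of _ "s * t"] exI[of _ c])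
    qed
  next
    case (4 w r)
    then show ?case using d by (auto simp: I_def)
  next
    case (5 q)
    then show ?case by blast
  qed
  obtain f where f: "linear f" "\<And>z. f z \<le> q z" using sublinear_dominates_linear[OF q(1)] by blast
  have fle: "f z \<le> norm z" for z using f(2) q(2) order_trans by blast
  have abs: "\<bar>f z\<bar> \<le> norm z" for z
    using fle[of z] fle[of "- z"] linear_neg[OF f(1), of z] by auto
  have bl: "bounded_linear f"
    by (intro bounded_linear.intro f(1) bounded_linear_axioms.intro exI[of _ 1]) (use abs in auto)
  show ?thesis
  proof (rule that[of "Blinfun f"])
    show "\<bar>blinfun_apply (Blinfun f) z\<bar> \<le> norm z" for z using abs by (simp add: bounded_linear_Blinfun_apply[OF bl])
    fix c assume "c \<in> C"
    then have "(1 *\<^sub>R (c - x), 1 * d) \<in> I" unfolding I_def by (intro insertI2 CollectI exI[of _ 1] exI[of _ c]) auto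
    then have "q (- (c - x)) \<le> - d" using q(3) by fastforce
    then have "f (- (c - x)) \<le> - d" using f(2) order_trans by blast
    then show "blinfun_apply (Blinfun f) x + d \<le> blinfun_apply (Blinfun f) c"
      using linear_diff[OF f(1), of x c] by (simp add: bounded_linear_Blinfun_apply[OF bl])
  qed
qed

lemma norming_functional:
  fixes x :: "'a::real_normed_vector"
  obtains f :: "'a \<Rightarrow>\<^sub>L real"
  where "\<And>z. \<bar>blinfun_apply f z\<bar> \<le> norm z" "blinfun_apply f x = norm x"
proof -
  obtain f :: "'a \<Rightarrow>\<^sub>L real" where f: "\<And>z. \<bar>blinfun_apply f z\<bar> \<le> norm z"
    "\<And>c. c \<in> {x} \<Longrightarrow> blinfun_apply f 0 + norm x \<le> blinfun_apply f c"
    using functional_separating_from_convex[of "{x}" "norm x" 0] by auto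
  have "blinfun_apply f x = norm x" using f(1)[of x] f(2)[of x] by (auto simp: blinfun.zero_right)
  then show ?thesis using f that by blast
qed

section \<open>The weak topology\<close>

lemma openin_weak_vimage:
  fixes f :: "'a::real_normed_vector \<Rightarrow>\<^sub>L real"
  assumes "open U"
  shows "openin weak_topology (blinfun_apply f -` U)"
  unfolding weak_topology_def
proof (rule topology_generated_by_Basis, intro CollectI exI conjI)
  show "bounded_linear (blinfun_apply f)" by (rule blinfun.bounded_linear_right)
qed (use assms in auto)

lemma topspace_weak [simp]: "topspace weak_topology = UNIV"
  using openin_subset[OF openin_weak_vimage[OF open_UNIV, of 0]] by auto

lemma openin_weak_less:
  fixes f :: "'a::real_normed_vector \<Rightarrow>\<^sub>L real"
  shows "openin weak_topology {x. blinfun_apply f x < c}"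
  and openin_weak_greater: "openin weak_topology {x. c < blinfun_apply f x}"
  using openin_weak_vimage[OF open_lessThan, of f c] openin_weak_vimage[OF open_greaterThan, of f c]
  by (simp_all add: vimage_def)

lemma closedin_weak_ge:
  fixes f :: "'a::real_normed_vector \<Rightarrow>\<^sub>L real"
  shows "closedin weak_topology {x. c \<le> blinfun_apply f x}"
proof -
  have "UNIV - {x. c \<le> blinfun_apply f x} = {x. blinfun_apply f x < c}" by auto
  then show ?thesis by (simp add: closedin_def openin_weak_less)
qed

lemma continuous_map_weak_functional:
  fixes f :: "'a::real_normed_vector \<Rightarrow>\<^sub>L real"
  shows "continuous_map weak_topology euclideanreal (blinfun_apply f)"
  by (simp add: continuous_map_alt openin_weak_vimage)

lemma continuous_map_weak_linear:
  assumes "bounded_linear T"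
  shows "continuous_map weak_topology weak_topology T"
proof -
  have "openin weak_topology (T -` U)" if "U \<in> {f -` U | (f :: 'b \<Rightarrow> real) U. bounded_linear f \<and> open U}" for U
  proof -
    from that obtain f :: "'b \<Rightarrow> real" and V where "bounded_linear f" "open V" "U = f -` V"
      unfolding mem_Collect_eq by (elim exE conjE)
    then have "bounded_linear (f \<circ> T)" "T -` U = blinfun_apply (Blinfun (f \<circ> T)) -` V"
      using assms by (auto simp: bounded_linear_Blinfun_apply bounded_linear_compose comp_def)
    then show ?thesis using openin_weak_vimage[OF \<open>open V\<close>] by metis
  qed
  moreover have "\<Union> {f -` U | (f :: 'b \<Rightarrow> real) U. bounded_linear f \<and> open U} = UNIV"
    using topspace_weak[where 'a = 'b] unfolding weak_topology_def by simp
  ultimately show ?thesis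
    unfolding weak_topology_def[where 'a = 'b] continuous_on_generated_topo_iff by simp
qed

lemma weakly_compact_attains_sup:
  fixes f :: "'a::real_normed_vector \<Rightarrow>\<^sub>L real"
  assumes "compactin weak_topology K" "K \<noteq> {}"
  obtains x where "x \<in> K" "\<And>y. y \<in> K \<Longrightarrow> blinfun_apply f y \<le> blinfun_apply f x"
proof -
  have "compact (blinfun_apply f ` K)"
    using image_compactin[OF assms(1) continuous_map_weak_functional] by simp
  then show ?thesis
    using compact_attains_sup[of "blinfun_apply f ` K"] assms(2) that by auto
qed

text \<open>
  The uniform boundedness principle: the functionals bounded by \<open>n\<close> on \<open>K\<close> form closed sets that
  cover the dual space, so one of them contains a ball of the dual space. This bounds on \<open>K\<close> all
  functionals of sufficiently small norm, in particular small multiples of norming functionals.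
\<close>

lemma weakly_compact_imp_bounded:
  fixes K :: "'a::real_normed_vector set"
  assumes K: "compactin weak_topology K"
  shows "bounded K"
proof (cases "K = {}")
  case False
  define F where "F n = {f :: 'a \<Rightarrow>\<^sub>L real. \<forall>x\<in>K. \<bar>blinfun_apply f x\<bar> \<le> real n}" for n
  have cl: "closed (F n)" for n
  proof -
    have "F n = (\<Inter>x\<in>K. {f. \<bar>blinfun_apply f x\<bar> \<le> real n})" by (auto simp: F_def)
    then show ?thesis
      by (auto intro!: closed_INT closed_Collect_le continuous_intros)
  qed
  have un: "\<Union> (range F) = UNIV"
  proof (intro set_eqI iffI UNIV_I)
    fix f :: "'a \<Rightarrow>\<^sub>L real"
    obtain x where x: "\<And>y. y \<in> K \<Longrightarrow> blinfun_apply f y \<le> blinfun_apply f x"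
      using weakly_compact_attains_sup[OF K False, of f] by metis
    obtain z where z: "\<And>y. y \<in> K \<Longrightarrow> blinfun_apply (- f) y \<le> blinfun_apply (- f) z"
      using weakly_compact_attains_sup[OF K False, of "- f"] by metis
    obtain n where n: "max \<bar>blinfun_apply f x\<bar> \<bar>blinfun_apply f z\<bar> \<le> real n" using real_arch_simple by blast
    have "\<bar>blinfun_apply f y\<bar> \<le> real n" if "y \<in> K" for y
      using x[OF that] z[OF that] n by (auto simp: blinfun.minus_left)
    then show "f \<in> \<Union> (range F)" by (auto simp: F_def)
  qed
  have "\<exists>n. interior (F n) \<noteq> {}"
  proof (rule ccontr)
    assume "\<not> ?thesis"
    then have "euclidean interior_of (\<Union> (range F)) = {}"
      using cl by (intro Baire_category_alt disjI1 completely_metrizable_space_euclidean) auto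
    then show False by (simp add: un)
  qed
  then obtain n g where "g \<in> interior (F n)" by blast
  then obtain r where r: "r > 0" "cball g r \<subseteq> F n"
    by (meson mem_interior_cball)
  have "norm x \<le> 2 * real n / r" if x: "x \<in> K" for x
  proof -
    obtain f :: "'a \<Rightarrow>\<^sub>L real" where f: "\<And>z. \<bar>blinfun_apply f z\<bar> \<le> norm z" "blinfun_apply f x = norm x"
      using norming_functional[of x] by blast
    have "norm f \<le> 1" by (rule norm_blinfun_bound) (use f in auto)
    then have "g + r *\<^sub>R f \<in> F n" "g \<in> F n"
      using r by (auto simp: dist_norm mult_left_le intro!: subsetD[OF r(2)])
    then have "\<bar>blinfun_apply g x + r * norm x\<bar> \<le> real n" "\<bar>blinfun_apply g x\<bar> \<le> real n"
      using x f(2) by (auto simp: F_def blinfun.add_left blinfun.scaleR_left)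
    then show ?thesis using r(1) by (simp add: field_simps)
  qed
  then show ?thesis by (auto simp: bounded_iff)
qed auto

text \<open>
  Any finitely many of the closed half-spaces that contain almost all terms have a term of the
  sequence in common, so the finite intersection property provides a point of \<open>K\<close> in all of them.
\<close>

lemma weak_cluster_point:
  fixes K :: "'a::real_normed_vector set"
  assumes K: "compactin weak_topology K" and x: "\<And>n. x n \<in> K"
  obtains z where "z \<in> K"
    "\<And>(f :: 'a \<Rightarrow>\<^sub>L real) c. eventually (\<lambda>n. c \<le> blinfun_apply f (x n)) sequentially \<Longrightarrow> c \<le> blinfun_apply f z"
proof -
  define U where "U = {{y. c \<le> blinfun_apply f y} | (f :: 'a \<Rightarrow>\<^sub>L real) c. eventually (\<lambda>n. c \<le> blinfun_apply f (x n)) sequentially}"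
  have "K \<inter> \<Inter> U \<noteq> {}"
  proof (rule conjunct2[OF iffD1[OF compactin_fip K], rule_format], intro conjI ballI allI impI)
    show "closedin weak_topology C" if "C \<in> U" for C
      using that closedin_weak_ge by (auto simp: U_def)
    fix \<F> assume \<F>: "finite \<F> \<and> \<F> \<subseteq> U"
    then have "\<forall>C\<in>\<F>. eventually (\<lambda>n. x n \<in> C) sequentially"
      by (auto simp: U_def)
    with \<F> have "eventually (\<lambda>n. \<forall>C\<in>\<F>. x n \<in> C) sequentially"
      by (intro eventually_ball_finite) auto
    then obtain n where "\<forall>C\<in>\<F>. x n \<in> C"
      using eventually_happens[of _ sequentially] by auto
    then show "K \<inter> \<Inter> \<F> \<noteq> {}" using x by auto
  qed
  then obtain z where "z \<in> K" "z \<in> \<Inter> U" by blast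
  then show ?thesis by (intro that[of z]) (auto simp: U_def)
qed

text \<open>Mazur's theorem: a closed convex set is the intersection of the closed half-spaces containing it.\<close>

lemma weak_limit_in_closure:
  fixes Q :: "'a::real_normed_vector set"
  assumes Q: "convex (closure Q)" "Q \<noteq> {}"
    and z: "\<And>(f :: 'a \<Rightarrow>\<^sub>L real) c. (\<And>q. q \<in> Q \<Longrightarrow> c \<le> blinfun_apply f q) \<Longrightarrow> c \<le> blinfun_apply f z"
  shows "z \<in> closure Q"
proof (rule ccontr)
  assume "z \<notin> closure Q"
  define d where "d = infdist z (closure Q)"
  have d: "d > 0" "\<And>c. c \<in> closure Q \<Longrightarrow> d \<le> dist z c"
    using infdist_pos_not_in_closed[of "closure Q" z] \<open>z \<notin> closure Q\<close> Q(2) infdist_le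
    by (auto simp: d_def)
  obtain f :: "'a \<Rightarrow>\<^sub>L real" where f: "\<And>c. c \<in> closure Q \<Longrightarrow> blinfun_apply f z + d \<le> blinfun_apply f c"
  proof (rule functional_separating_from_convex[OF Q(1), of d z])
    show "d \<le> norm (c - z)" if "c \<in> closure Q" for c
      using d(2)[OF that] by (simp add: dist_norm norm_minus_commute)
  qed auto
  have "blinfun_apply f z + d \<le> blinfun_apply f z"
    by (rule z) (use f closure_subset in auto)
  then show False using d by simp
qed

section \<open>Fragmentability of weakly compact sets\<close>

text \<open>
  Closing a countable set under convex combinations of two points with rational coefficients keeps
  it countable, and the density of the rationals makes its closure convex. This is the separable
  set that traps the weak cluster points in the next lemma.
\<close>

lemma countable_superset_convex_closure:
  fixes P :: "'a::real_normed_vector set"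
  assumes P: "countable P"
  obtains Q where "P \<subseteq> Q" "countable Q" "convex (closure Q)"
proof -
  define R where "R = {r::real. r \<in> \<rat> \<and> 0 \<le> r \<and> r \<le> 1}"
  have R: "countable R" unfolding R_def using countable_rat by (rule countable_subset[rotated]) auto
  define G where "G A = (\<lambda>(r, x, y). (1 - r) *\<^sub>R x + r *\<^sub>R y) ` (R \<times> A \<times> A)" for A :: "'a set"
  define H where "H n = (G ^^ n) P" for n
  have H0: "H 0 = P" and HS: "H (Suc n) = G (H n)" for n by (auto simp: H_def)
  have incr: "A \<subseteq> G A" for A
  proof
    fix x assume "x \<in> A"
    then show "x \<in> G A" unfolding G_def R_def by (intro image_eqI[of _ _ "(0, x, x)"]) auto
  qed
  have mono: "H m \<subseteq> H n" if "m \<le> n" for m n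
    using lift_Suc_mono_le[of H m n] that incr by (auto simp: HS)
  define Q where "Q = (\<Union>n. H n)"
  show ?thesis
  proof
    show "P \<subseteq> Q" using H0 by (auto simp: Q_def)
    have "countable (H n)" for n
      by (induction n) (auto simp: H0 HS P G_def R intro!: countable_image countable_SIGMA)
    then show "countable Q" by (auto simp: Q_def)
    have comb: "(1 - r) *\<^sub>R x + r *\<^sub>R y \<in> Q" if "r \<in> R" "x \<in> Q" "y \<in> Q" for r x y
    proof -
      from that obtain m n where "x \<in> H m" "y \<in> H n" by (auto simp: Q_def)
      then have "x \<in> H (max m n)" "y \<in> H (max m n)" using mono by (meson max.cobounded1 max.cobounded2 subsetD)+
      then have "(1 - r) *\<^sub>R x + r *\<^sub>R y \<in> H (Suc (max m n))"
        unfolding HS G_def using that(1) by (intro image_eqI[of _ _ "(r, x, y)"]) auto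
      then show ?thesis by (auto simp: Q_def)
    qed
    have clR: "{0..1} \<subseteq> closure R"
    proof
      fix u :: real assume u: "u \<in> {0..1}"
      show "u \<in> closure R"
        unfolding closure_approachable
      proof (intro allI impI)
        fix e :: real assume e: "e > 0"
        show "\<exists>y\<in>R. dist y u < e"
        proof (cases "u = 1")
          case True
          then show ?thesis using e by (intro bexI[of _ 1]) (auto simp: R_def)
        next
          case False
          then obtain r where "r \<in> \<rat>" "u < r" "r < min 1 (u + e)"
            using Rats_dense_in_real[of u "min 1 (u + e)"] u e by auto
          then show ?thesis using u by (intro bexI[of _ r]) (auto simp: R_def dist_real_def)
        qed
      qed
    qed
    have sub: "(\<lambda>(r, x, y). (1 - r) *\<^sub>R x + r *\<^sub>R y) ` closure (R \<times> Q \<times> Q) \<subseteq> closure Q"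
    proof (rule image_closure_subset)
      show "continuous_on (closure (R \<times> Q \<times> Q)) (\<lambda>(r, x, y). (1 - r) *\<^sub>R x + r *\<^sub>R y)"
        by (auto simp: case_prod_beta intro!: continuous_intros)
      show "(\<lambda>(r, x, y). (1 - r) *\<^sub>R x + r *\<^sub>R y) ` (R \<times> Q \<times> Q) \<subseteq> closure Q"
        using comb closure_subset by fastforce
    qed simp
    show "convex (closure Q)"
      unfolding convex_alt
    proof (intro ballI allI impI)
      fix x y and u :: real assume "x \<in> closure Q" "y \<in> closure Q" "0 \<le> u \<and> u \<le> 1"
      then have "(u, x, y) \<in> closure (R \<times> Q \<times> Q)" using clR by (auto simp: closure_Times)
      then show "(1 - u) *\<^sub>R x + u *\<^sub>R y \<in> closure Q" using sub by fastforce
    qed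
  qed
qed

text \<open>
  If every non-empty relatively open set had diameter above \<open>e\<close>, each could be split by two
  half-spaces of a functional of norm at most one into two non-empty pieces at distance at least
  \<open>e\<close>. Iteration gives a binary tree of weakly open sets. Along each branch, points picked
  from the tree have a weak cluster point in \<open>E\<close>, and different branches give cluster points at
  distance at least \<open>e\<close>. All picked points belong to one countable set, so by Mazur's theorem the
  cluster points lie in a separable set, which has no uncountable \<open>e\<close>-separated subset.
\<close>

lemma weakly_compact_fragmented:
  fixes E :: "'a::real_normed_vector set"
  assumes E: "compactin weak_topology E" "E \<noteq> {}" and e: "e > 0"
  obtains V where "openin weak_topology V" "E \<inter> V \<noteq> {}"
    "\<forall>x\<in>E \<inter> V. \<forall>y\<in>E \<inter> V. dist x y \<le> e"
proof (rule ccontr)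
  assume contr: "\<not> thesis"
  note small = that
  have split: "\<exists>(f :: 'a \<Rightarrow>\<^sub>L real) c. \<forall>b. E \<inter> (V \<inter> (if b then {x. c + e < blinfun_apply f x} else {x. blinfun_apply f x < c})) \<noteq> {}
      \<and> (\<forall>z. \<bar>blinfun_apply f z\<bar> \<le> norm z)"
    if V: "openin weak_topology V" "E \<inter> V \<noteq> {}" for V
  proof -
    have "\<not> (\<forall>x\<in>E \<inter> V. \<forall>y\<in>E \<inter> V. dist x y \<le> e)" using contr small[of V] V by blast
    then obtain x y where xy: "x \<in> E \<inter> V" "y \<in> E \<inter> V" "dist x y > e"
      by (auto simp: not_le)
    obtain f :: "'a \<Rightarrow>\<^sub>L real" where f: "\<And>z. \<bar>blinfun_apply f z\<bar> \<le> norm z" "blinfun_apply f (x - y) = norm (x - y)"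
      using norming_functional[of "x - y"] by blast
    define c where "c = (blinfun_apply f x + blinfun_apply f y - e) / 2"
    have "blinfun_apply f x - blinfun_apply f y > e" using f(2) xy(3) by (simp add: blinfun.diff_right dist_norm)
    then have "c + e < blinfun_apply f x" "blinfun_apply f y < c" by (auto simp: c_def field_simps)
    then show ?thesis using xy f(1) by (intro exI[of _ f] exI[of _ c]) auto
  qed
  define ok where "ok V f c \<longleftrightarrow> (\<forall>b. E \<inter> (V \<inter> (if b then {x. c + e < blinfun_apply f x} else {x. blinfun_apply f x < c})) \<noteq> {}
      \<and> (\<forall>z. \<bar>blinfun_apply f z\<bar> \<le> norm z))" for V and f :: "'a \<Rightarrow>\<^sub>L real" and c
  have "\<exists>f c. \<forall>V. openin weak_topology V \<and> E \<inter> V \<noteq> {} \<longrightarrow> ok V (f V) (c V)"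
    using split unfolding ok_def[symmetric] by metis
  then obtain f c where fc: "\<And>V. openin weak_topology V \<Longrightarrow> E \<inter> V \<noteq> {} \<Longrightarrow> ok V (f V) (c V)" by blast
  define st where "st b V = V \<inter> (if b then {x. c V + e < blinfun_apply (f V) x} else {x. blinfun_apply (f V) x < c V})" for b V
  \<comment> \<open>\<open>W bs\<close> is the node of the tree that is reached by the choices \<open>bs\<close>; a branch is a set of
    naturals, namely the levels at which the upper half-space is chosen.\<close>
  define W where "W bs = fold st bs UNIV" for bs
  have step: "openin weak_topology (st b V) \<and> E \<inter> st b V \<noteq> {}"
    if "openin weak_topology V" "E \<inter> V \<noteq> {}" for b V
    using fc[OF that] openin_Int[OF that(1)] openin_weak_less[where f = "f V" and c = "c V"] openin_weak_greater[where f = "f V" and c = "c V + e"]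
    unfolding ok_def st_def by auto
  have fold: "openin weak_topology (fold st bs V) \<and> E \<inter> fold st bs V \<noteq> {}"
    if "openin weak_topology V" "E \<inter> V \<noteq> {}" for bs V
    using that by (induction bs arbitrary: V) (use step in auto)
  have W: "openin weak_topology (W bs)" "E \<inter> W bs \<noteq> {}" for bs
    using fold[of UNIV bs] E(2) openin_topspace[of "weak_topology :: 'a topology"] by (auto simp: W_def)
  define p where "p bs = (SOME x. x \<in> E \<inter> W bs)" for bs
  have pEW: "p bs \<in> E \<inter> W bs" for bs
    unfolding p_def by (rule someI_ex) (use W(2)[of bs] in auto)
  have p: "p bs \<in> E" "p bs \<in> W bs" for bs
    using IntD1[OF pEW[of bs]] IntD2[OF pEW[of bs]] .
  obtain Q where Q: "range p \<subseteq> Q" "countable Q" "convex (closure Q)"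
    by (rule countable_superset_convex_closure[of "range p"]) auto
  define br where "br \<sigma> n = map (\<lambda>i. i \<in> \<sigma>) [0..<n]" for \<sigma> :: "nat set" and n
  have Wsuc: "W (br \<sigma> (Suc n)) = st (n \<in> \<sigma>) (W (br \<sigma> n))" for \<sigma> n by (simp add: W_def br_def)
  have Wmono: "W (br \<sigma> n) \<subseteq> W (br \<sigma> m)" if "m \<le> n" for \<sigma> m n
    using that by (induction n rule: dec_induct) (auto simp: Wsuc st_def)
  have "\<exists>z. \<forall>(g :: 'a \<Rightarrow>\<^sub>L real) r. eventually (\<lambda>n. r \<le> blinfun_apply g (p (br \<sigma> n))) sequentially \<longrightarrow> r \<le> blinfun_apply g z" for \<sigma>
    using weak_cluster_point[OF E(1), of "\<lambda>n. p (br \<sigma> n)"] p(1) by metis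
  then obtain z where z: "\<And>\<sigma> (g :: 'a \<Rightarrow>\<^sub>L real) r. eventually (\<lambda>n. r \<le> blinfun_apply g (p (br \<sigma> n))) sequentially
      \<Longrightarrow> r \<le> blinfun_apply g (z \<sigma>)" by metis
  have zQ: "z \<sigma> \<in> closure Q" for \<sigma>
  proof (rule weak_limit_in_closure[OF Q(3)])
    show "Q \<noteq> {}" using Q(1) by auto
    show "r \<le> blinfun_apply g (z \<sigma>)" if "\<And>q. q \<in> Q \<Longrightarrow> r \<le> blinfun_apply g q" for g :: "'a \<Rightarrow>\<^sub>L real" and r
      using that Q(1) by (intro z always_eventually) auto
  qed
  \<comment> \<open>Weak inequalities suffice: the cluster points may leave the open half-spaces, but their values
    under the functional at the branching node still differ by at least \<open>e\<close>.\<close>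
  have sep1: "e \<le> dist (z \<sigma>) (z \<tau>)" if n: "n \<in> \<sigma>" "n \<notin> \<tau>" "\<And>i. i < n \<Longrightarrow> i \<in> \<sigma> \<longleftrightarrow> i \<in> \<tau>" for \<sigma> \<tau> n
  proof -
    define V where "V = W (br \<sigma> n)"
    have V': "V = W (br \<tau> n)" using n(3) by (auto simp: V_def br_def intro!: arg_cong[of _ _ W])
    have ev: "eventually (\<lambda>k. p (br \<rho> k) \<in> W (br \<rho> (Suc n))) sequentially" for \<rho>
      unfolding eventually_sequentially by (intro exI[of _ "Suc n"] allI impI subsetD[OF Wmono p(2)])
    have "c V + e \<le> blinfun_apply (f V) (z \<sigma>)"
      by (rule z, rule eventually_mono[OF ev[of \<sigma>]]) (use n in \<open>auto simp: Wsuc st_def V_def\<close>)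
    moreover have "- c V \<le> blinfun_apply (- f V) (z \<tau>)"
      by (rule z, rule eventually_mono[OF ev[of \<tau>]]) (use n in \<open>auto simp: Wsuc st_def V' blinfun.minus_left\<close>)
    moreover have "\<bar>blinfun_apply (f V) (z \<sigma> - z \<tau>)\<bar> \<le> norm (z \<sigma> - z \<tau>)"
      using fc[OF W[of "br \<sigma> n"]] by (simp add: ok_def V_def)
    ultimately show ?thesis by (simp add: blinfun.minus_left blinfun.diff_right dist_norm)
  qed
  have sep: "e \<le> dist (z \<sigma>) (z \<tau>)" if "\<sigma> \<noteq> \<tau>" for \<sigma> \<tau>
  proof -
    define n where "n = (LEAST n. n \<in> \<sigma> \<longleftrightarrow> n \<notin> \<tau>)"
    have ex: "\<exists>n. n \<in> \<sigma> \<longleftrightarrow> n \<notin> \<tau>" using that by blast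
    have 1: "n \<in> \<sigma> \<longleftrightarrow> n \<notin> \<tau>" unfolding n_def by (rule LeastI_ex[OF ex])
    have 2: "i \<in> \<sigma> \<longleftrightarrow> i \<in> \<tau>" if "i < n" for i using not_less_Least that unfolding n_def by blast
    show ?thesis
      using sep1[of n \<sigma> \<tau>] sep1[of n \<tau> \<sigma>] 1 2 by (cases "n \<in> \<sigma>") (auto simp: dist_commute)
  qed
  have "\<exists>q\<in>Q. dist q (z \<sigma>) < e / 2" for \<sigma>
    using zQ[of \<sigma>] e unfolding closure_approachable by (meson half_gt_zero)
  then obtain q where q: "\<And>\<sigma>. q \<sigma> \<in> Q" "\<And>\<sigma>. dist (q \<sigma>) (z \<sigma>) < e / 2" by metis
  \<comment> \<open>Points of \<open>Q\<close> within \<open>e / 2\<close> of the cluster points are distinct for distinct branches.\<close>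
  have "inj q"
  proof (rule injI, rule ccontr)
    fix \<sigma> \<tau> assume "q \<sigma> = q \<tau>" "\<sigma> \<noteq> \<tau>"
    then show False
      using sep[of \<sigma> \<tau>] q(2)[of \<sigma>] q(2)[of \<tau>] dist_triangle3[of "z \<sigma>" "z \<tau>" "q \<sigma>"] by simp
  qed
  moreover have "countable (range q)" using Q(2) q(1) by (meson countable_subset image_subsetI)
  ultimately have "countable (UNIV :: nat set set)" using countable_image_inj_eq by blast
  then obtain h :: "nat \<Rightarrow> nat set" where "range h = UNIV"
    using uncountable_def[of "UNIV :: nat set set"] by blast
  then show False using Cantors_theorem[of "UNIV :: nat set"] by auto
qed

section \<open>Small slices away from a convex set\<close>

definition small_slice :: "'a::real_normed_vector set \<Rightarrow> real \<Rightarrow> ('a \<Rightarrow>\<^sub>L real) \<Rightarrow> real \<Rightarrow> bool" where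
  "small_slice K e g s \<longleftrightarrow> (\<exists>k\<in>K. s < blinfun_apply g k) \<and>
     (\<forall>x\<in>K. \<forall>y\<in>K. s < blinfun_apply g x \<longrightarrow> s < blinfun_apply g y \<longrightarrow> dist x y \<le> e)"

text \<open>
  Here \<open>good g k\<close> says that \<open>g\<close> is maximal over \<open>K\<close> at \<open>k\<close> and that this maximum exceeds the
  values of \<open>g\<close> on \<open>D\<close> by a positive amount. The set \<open>K - U\<close> is a minimal weakly closed subset of
  \<open>K\<close> on which all these maxima are still attained; together with \<open>D\<close> it generates a closed convex
  set containing \<open>K\<close>, and it takes the place of the extreme points of \<open>K\<close>. Minimality
  means that removing any relatively open piece strictly lowers some of the maxima. Stated through
  the complements \<open>U\<close>, this is a maximality statement, and compactness of the face on which \<open>g\<close> is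
  maximal gives the upper bounds of chains.
\<close>

lemma minimal_attaining_set:
  fixes K D :: "'a::real_normed_vector set"
  assumes K: "compactin weak_topology K"
  defines "good \<equiv> \<lambda>(g :: 'a \<Rightarrow>\<^sub>L real) k. k \<in> K \<and> (\<forall>x\<in>K. blinfun_apply g x \<le> blinfun_apply g k) \<and>
      (\<exists>s<blinfun_apply g k. \<forall>d\<in>D. blinfun_apply g d \<le> s)"
  obtains U where "openin weak_topology U"
    "\<And>g k. good g k \<Longrightarrow> \<exists>x\<in>K - U. blinfun_apply g x = blinfun_apply g k"
    "\<And>V. openin weak_topology V \<Longrightarrow> (K - U) \<inter> V \<noteq> {} \<Longrightarrow>
       \<exists>g k. good g k \<and> (\<forall>x\<in>K - U - V. blinfun_apply g x < blinfun_apply g k)"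
proof -
  define A where "A = {U. openin weak_topology U \<and>
      (\<forall>g k. good g k \<longrightarrow> (\<exists>x\<in>K - U. blinfun_apply g x = blinfun_apply g k))}"
  have "{} \<in> A" by (auto simp: A_def good_def)
  have "\<exists>M\<in>A. \<forall>X\<in>A. M \<subseteq> X \<longrightarrow> X = M"
  proof (rule subset_Zorn_nonempty)
    show "A \<noteq> {}" using \<open>{} \<in> A\<close> by auto
    fix C assume C: "C \<noteq> {}" "subset.chain A C"
    then have CA: "C \<subseteq> A" by (simp add: subset.chain_def)
    have "\<exists>x\<in>K - \<Union>C. blinfun_apply g x = blinfun_apply g k" if g: "good g k" for g k
    proof (rule ccontr)
      assume no: "\<not> ?thesis"
      define L where "L = {x. blinfun_apply g k \<le> blinfun_apply g x} \<inter> K"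
      have L: "compactin weak_topology L"
        unfolding L_def by (rule closed_Int_compactin[OF closedin_weak_ge K])
      have Lmax: "L = {x\<in>K. blinfun_apply g x = blinfun_apply g k}"
        using g by (force simp: L_def good_def)
      have "L \<subseteq> \<Union>C" using no by (auto simp: Lmax)
      moreover have "\<forall>U\<in>C. openin weak_topology U" using CA by (auto simp: A_def)
      ultimately obtain F where F: "finite F" "F \<subseteq> C" "L \<subseteq> \<Union>F"
        using L unfolding compactin_def by metis
      have "k \<in> L" using g by (auto simp: Lmax good_def)
      then have "F \<noteq> {}" using F(3) by auto
      moreover have "subset.chain A F"
        using C(2) F(2) unfolding subset.chain_def by blast
      ultimately have "\<Union>F \<in> F" using F(1) by (intro Union_in_chain)
      then have "\<Union>F \<in> A" using F(2) CA by blast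
      then have "\<exists>x\<in>K - \<Union>F. blinfun_apply g x = blinfun_apply g k"
        using g by (simp add: A_def)
      then obtain x where "x \<in> K - \<Union>F" "blinfun_apply g x = blinfun_apply g k" ..
      then show False using F(3) by (auto simp: Lmax)
    qed
    moreover have "openin weak_topology (\<Union>C)" using CA by (intro openin_Union) (auto simp: A_def)
    ultimately show "\<Union>C \<in> A" by (auto simp: A_def)
  qed
  then obtain U where U: "U \<in> A" "\<And>X. X \<in> A \<Longrightarrow> U \<subseteq> X \<Longrightarrow> X = U" by blast
  show ?thesis
  proof (rule that[of U])
    show "openin weak_topology U" using U(1) by (simp add: A_def)
    show "\<exists>x\<in>K - U. blinfun_apply g x = blinfun_apply g k" if "good g k" for g k
      using U(1) that by (simp add: A_def)
    fix V :: "'a set" assume V: "openin weak_topology V" "(K - U) \<inter> V \<noteq> {}"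
    then have "U \<union> V \<notin> A" using U(2)[of "U \<union> V"] by blast
    moreover have "openin weak_topology (U \<union> V)" using V(1) U(1) by (simp add: A_def openin_Un)
    ultimately obtain g k where gk: "good g k"
      "\<forall>x\<in>K - (U \<union> V). blinfun_apply g x \<noteq> blinfun_apply g k"
      by (auto simp: A_def)
    have "blinfun_apply g x < blinfun_apply g k" if "x \<in> K - U - V" for x
    proof -
      have "blinfun_apply g x \<le> blinfun_apply g k" using gk(1) that by (simp add: good_def)
      moreover have "blinfun_apply g x \<noteq> blinfun_apply g k" using gk(2) that by blast
      ultimately show ?thesis by simp
    qed
    with gk(1) show "\<exists>g k. good g k \<and> (\<forall>x\<in>K - U - V. blinfun_apply g x < blinfun_apply g k)" by blast
  qed
qed

text \<open>
  The two parts of a convex combination of such points are collected separately, each being a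
  multiple of a point of \<open>A\<close> or of \<open>B\<close>.
\<close>

lemma convex_join:
  fixes A B :: "'a::real_vector set"
  assumes "convex A" "convex B"
  shows "convex {(1 - l) *\<^sub>R a + l *\<^sub>R b | l a b. 0 \<le> l \<and> l \<le> 1 \<and> a \<in> A \<and> b \<in> B}"
proof (rule convexI)
  have mix: "\<exists>z\<in>S. p *\<^sub>R x + q *\<^sub>R y = (p + q) *\<^sub>R z"
    if "convex S" "x \<in> S" "y \<in> S" "0 \<le> p" "0 \<le> q" for S :: "'a set" and x y p q
  proof (cases "p + q = 0")
    case True
    then have "p = 0" "q = 0" using that by auto
    then show ?thesis using that by auto
  next
    case False
    have "(p / (p + q)) *\<^sub>R x + (q / (p + q)) *\<^sub>R y \<in> S"
      using that False by (intro convexD[OF that(1)]) (auto simp: add_divide_distrib[symmetric])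
    then show ?thesis using False by (intro bexI) (auto simp: scaleR_add_right)
  qed
  fix x y and u v :: real
  assume uv: "0 \<le> u" "0 \<le> v" "u + v = 1"
  assume "x \<in> {(1 - l) *\<^sub>R a + l *\<^sub>R b | l a b. 0 \<le> l \<and> l \<le> 1 \<and> a \<in> A \<and> b \<in> B}"
  then obtain l a b where x: "0 \<le> l" "l \<le> 1" "a \<in> A" "b \<in> B" "x = (1 - l) *\<^sub>R a + l *\<^sub>R b" by blast
  assume "y \<in> {(1 - l) *\<^sub>R a + l *\<^sub>R b | l a b. 0 \<le> l \<and> l \<le> 1 \<and> a \<in> A \<and> b \<in> B}"
  then obtain m c d where y: "0 \<le> m" "m \<le> 1" "c \<in> A" "d \<in> B" "y = (1 - m) *\<^sub>R c + m *\<^sub>R d" by blast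
  obtain a' where a': "a' \<in> A"
    "(u * (1 - l)) *\<^sub>R a + (v * (1 - m)) *\<^sub>R c = (u * (1 - l) + v * (1 - m)) *\<^sub>R a'"
    using mix[OF assms(1) x(3) y(3), of "u * (1 - l)" "v * (1 - m)"] uv x y by auto
  obtain b' where b': "b' \<in> B"
    "(u * l) *\<^sub>R b + (v * m) *\<^sub>R d = (u * l + v * m) *\<^sub>R b'"
    using mix[OF assms(2) x(4) y(4), of "u * l" "v * m"] uv x y by auto
  have lm: "u * (1 - l) + v * (1 - m) = 1 - (u * l + v * m)" using uv(3) by (simp add: algebra_simps)
  have "u *\<^sub>R x + v *\<^sub>R y = ((u * (1 - l)) *\<^sub>R a + (v * (1 - m)) *\<^sub>R c) + ((u * l) *\<^sub>R b + (v * m) *\<^sub>R d)"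
    unfolding x(5) y(5) by (simp add: scaleR_add_right)
  also have "\<dots> = (1 - (u * l + v * m)) *\<^sub>R a' + (u * l + v * m) *\<^sub>R b'"
    unfolding a'(2) b'(2) lm ..
  finally have "u *\<^sub>R x + v *\<^sub>R y = (1 - (u * l + v * m)) *\<^sub>R a' + (u * l + v * m) *\<^sub>R b'" .
  moreover have "0 \<le> u * l + v * m" using uv x y by auto
  moreover have "u * l + v * m \<le> 1"
  proof -
    have "u * l \<le> u * 1" "v * m \<le> v * 1" using uv x(2) y(2) by (intro mult_left_mono; simp)+
    then show ?thesis using uv by linarith
  qed
  ultimately show "u *\<^sub>R x + v *\<^sub>R y \<in> {(1 - l) *\<^sub>R a + l *\<^sub>R b | l a b. 0 \<le> l \<and> l \<le> 1 \<and> a \<in> A \<and> b \<in> B}"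
    using a'(1) b'(1) by blast
qed

lemma functional_le_on_convex_hull:
  assumes "\<And>x. x \<in> S \<Longrightarrow> blinfun_apply g x \<le> (s :: real)" "x \<in> convex hull S"
  shows "blinfun_apply g x \<le> s"
proof -
  have "convex {x. blinfun_apply g x \<le> s}"
    by (auto simp: convex_def blinfun.add_right blinfun.scaleR_right intro!: convex_bound_le)
  then have "convex hull S \<subseteq> {x. blinfun_apply g x \<le> s}" using assms(1) by (intro hull_minimal) auto
  then show ?thesis using assms(2) by auto
qed

text \<open>
  The Bourgain-Namioka superlemma. Let \<open>C\<close> be the convex set generated by the points
  \<open>(1 - l) a + l b\<close> with \<open>l \<ge> r\<close>. It stays away from \<open>k\<close> for every \<open>r > 0\<close>, because \<open>g1\<close> is
  nowhere larger on \<open>K0\<close> than at \<open>k\<close>, and smaller by a fixed amount on \<open>K1\<close>. A functional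
  separating \<open>k\<close> from \<open>C\<close> cuts off a slice of \<open>K\<close> without points of \<open>C\<close>. Hence the points of this
  slice are limits of combinations with \<open>l < r\<close>, which are close to \<open>K0\<close> when \<open>r\<close> is small.
\<close>

lemma slice_away_from_one_side_of_join:
  fixes K K0 K1 :: "'a::real_normed_vector set"
  assumes K0: "K0 \<subseteq> cball a0 r0" and K1: "K1 \<noteq> {}" and bd: "bounded K1" "k \<in> K"
    and join: "K \<subseteq> closure {(1 - l) *\<^sub>R a + l *\<^sub>R b | l a b. 0 \<le> l \<and> l \<le> 1 \<and> a \<in> K0 \<and> b \<in> K1}"
    and g1: "\<And>x. x \<in> K0 \<Longrightarrow> blinfun_apply g1 x \<le> blinfun_apply g1 k" "\<And>x. x \<in> K1 \<Longrightarrow> blinfun_apply g1 x \<le> s1"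
      "s1 < (blinfun_apply g1 k :: real)"
    and e: "2 * r0 < e" "0 \<le> r0"
  obtains g s where "small_slice K e g s" "\<And>x. x \<in> K1 \<Longrightarrow> blinfun_apply g x \<le> s"
proof -
  obtain B where B: "B > 0" "\<And>a b. a \<in> K0 \<Longrightarrow> b \<in> K1 \<Longrightarrow> norm (b - a) \<le> B"
  proof -
    obtain b1 where b1: "\<And>b. b \<in> K1 \<Longrightarrow> norm b \<le> b1" "b1 > 0"
      using bd(1) unfolding bounded_pos by blast
    have "norm (b - a) \<le> b1 + (norm a0 + r0)" if "a \<in> K0" "b \<in> K1" for a b
    proof -
      have "norm (a0 - a) \<le> r0" using K0 that(1) by (auto simp: dist_norm)
      then have "norm a \<le> norm a0 + r0" using norm_triangle_ineq4[of a0 "a0 - a"] by simp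
      then show ?thesis using b1(1)[OF that(2)] norm_triangle_ineq4[of b a] by linarith
    qed
    then show ?thesis using b1(2) e(2) by (intro that[of "b1 + (norm a0 + r0)"]) (auto intro: add_pos_nonneg)
  qed
  define \<tau> where "\<tau> = (e / 2 - r0) / 2"
  have \<tau>: "\<tau> > 0" using e by (simp add: \<tau>_def)
  define r where "r = min (1/2) (\<tau> / B)"
  have r: "0 < r" "r < 1" "r * B \<le> \<tau>"
    using \<tau> B(1) by (auto simp: r_def min_def field_simps)
  \<comment> \<open>Taking a hull makes convexity immediate; the combinations with \<open>l \<ge> r\<close> lie in it, since each
    is a combination of one with coefficient exactly \<open>r\<close> and of a point of \<open>K1\<close>.\<close>
  define G where "G = K1 \<union> {(1 - r) *\<^sub>R a + r *\<^sub>R b | a b. a \<in> K0 \<and> b \<in> K1}"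
  define C where "C = convex hull G"
  define s2 where "s2 = (1 - r) * blinfun_apply g1 k + r * s1"
  have s2: "s2 < blinfun_apply g1 k"
  proof -
    have "r * s1 < r * blinfun_apply g1 k" using r g1(3) by simp
    then show ?thesis by (simp add: s2_def algebra_simps)
  qed
  have Gle: "blinfun_apply g1 x \<le> s2" if "x \<in> G" for x
  proof -
    consider "x \<in> K1" | a b where "a \<in> K0" "b \<in> K1" "x = (1 - r) *\<^sub>R a + r *\<^sub>R b"
      using \<open>x \<in> G\<close> unfolding G_def by blast
    then show ?thesis
    proof cases
      case 1
      have "(1 - r) * s1 \<le> (1 - r) * blinfun_apply g1 k" using r g1(3) by (intro mult_left_mono) auto
      then have "s1 \<le> s2" by (simp add: s2_def algebra_simps)
      then show ?thesis using g1(2)[OF 1] by linarith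
    next
      case 2
      have "(1 - r) * blinfun_apply g1 a \<le> (1 - r) * blinfun_apply g1 k" "r * blinfun_apply g1 b \<le> r * s1"
        using r g1(1)[OF 2(1)] g1(2)[OF 2(2)] by (auto intro!: mult_left_mono)
      then show ?thesis unfolding 2(3) s2_def by (simp add: blinfun.add_right blinfun.scaleR_right)
    qed
  qed
  have Cle: "blinfun_apply g1 x \<le> s2" if "x \<in> C" for x
    using functional_le_on_convex_hull[of G g1 s2 x] Gle that by (auto simp: C_def)
  have g1pos: "norm g1 > 0"
  proof (rule ccontr)
    assume "\<not> ?thesis"
    then have "g1 = 0" by simp
    moreover obtain b where "b \<in> K1" using K1 by auto
    ultimately show False using g1(2)[of b] g1(3) by (simp add: blinfun.zero_left)
  qed
  define d where "d = (blinfun_apply g1 k - s2) / norm g1"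
  have d: "d > 0" using s2 g1pos by (simp add: d_def)
  have dC: "d \<le> norm (c - k)" if "c \<in> C" for c
  proof -
    have "blinfun_apply g1 k - s2 \<le> blinfun_apply g1 (k - c)"
      using Cle[OF that] by (simp add: blinfun.diff_right)
    also have "\<dots> \<le> norm g1 * norm (c - k)"
      using norm_blinfun[of g1 "k - c"] by (simp add: norm_minus_commute)
    finally show ?thesis using g1pos by (simp add: d_def field_simps)
  qed
  obtain f :: "'a \<Rightarrow>\<^sub>L real" where f: "\<And>z. \<bar>blinfun_apply f z\<bar> \<le> norm z"
    "\<And>c. c \<in> C \<Longrightarrow> blinfun_apply f k + d \<le> blinfun_apply f c"
    by (rule functional_separating_from_convex[of C d k, OF _ dC]) (auto simp: C_def convex_convex_hull)
  define g where "g = - f"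
  define s where "s = blinfun_apply g k - d"
  have gC: "blinfun_apply g c \<le> s" if "c \<in> C" for c
    using f(2)[OF that] by (simp add: g_def s_def blinfun.minus_left)
  have near: "norm (x - a0) \<le> e / 2" if x: "x \<in> K" "s < blinfun_apply g x" for x
  proof -
    define t where "t = min \<tau> (blinfun_apply g x - s)"
    have "t > 0" using \<tau> x(2) by (simp add: t_def)
    with subsetD[OF join x(1)] obtain w
      where w: "w \<in> {(1 - l) *\<^sub>R a + l *\<^sub>R b | l a b. 0 \<le> l \<and> l \<le> 1 \<and> a \<in> K0 \<and> b \<in> K1}" "dist w x < t"
      unfolding closure_approachable by blast
    from w(1) obtain l a b where l: "0 \<le> l" "l \<le> 1" "a \<in> K0" "b \<in> K1" "w = (1 - l) *\<^sub>R a + l *\<^sub>R b" by blast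
    have "\<bar>blinfun_apply f (w - x)\<bar> < t" using f(1)[of "w - x"] w(2) by (simp add: dist_norm)
    then have "s < blinfun_apply g w"
      unfolding g_def t_def blinfun.minus_left blinfun.diff_right min_less_iff_conj by linarith
    then have wC: "w \<notin> C" using gC by fastforce
    have "l < r"
    proof (rule ccontr)
      assume "\<not> l < r"
      then have lr: "r \<le> l" by simp
      define q where "q = (1 - l) / (1 - r)"
      have q: "0 \<le> q" "q \<le> 1" "q * (1 - r) = 1 - l" using lr l r by (auto simp: q_def field_simps)
      have "q *\<^sub>R ((1 - r) *\<^sub>R a + r *\<^sub>R b) + (1 - q) *\<^sub>R b \<in> C"
        unfolding C_def
        by (intro convexD[OF convex_convex_hull] hull_inc) (use q l in \<open>auto simp: G_def\<close>)
      also have "q *\<^sub>R ((1 - r) *\<^sub>R a + r *\<^sub>R b) + (1 - q) *\<^sub>R b = (q * (1 - r)) *\<^sub>R a + (1 - q * (1 - r)) *\<^sub>R b"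
        by (simp add: algebra_simps)
      also have "\<dots> = w" unfolding q(3) l(5) by simp
      finally show False using wC by simp
    qed
    have "w - a = l *\<^sub>R (b - a)" unfolding l(5) by (simp add: algebra_simps)
    then have "norm (w - a) = l * norm (b - a)" using l by simp
    also have "\<dots> \<le> r * B" using \<open>l < r\<close> l B by (intro mult_mono) auto
    finally have 1: "norm (w - a) \<le> \<tau>" using r by linarith
    have 2: "norm (x - w) \<le> \<tau>" using w(2) by (simp add: t_def dist_norm norm_minus_commute)
    have 3: "norm (a - a0) \<le> r0" using K0 l(3) by (auto simp: dist_norm norm_minus_commute)
    have "norm (x - a0) \<le> norm (x - w) + norm (w - a) + norm (a - a0)"
      using norm_triangle_ineq[of "x - w" "w - a"] norm_triangle_ineq[of "x - w + (w - a)" "a - a0"] by simp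
    also have "\<dots> \<le> \<tau> + \<tau> + r0" using 1 2 3 by linarith
    also have "\<dots> = e / 2" by (simp add: \<tau>_def)
    finally show ?thesis .
  qed
  have "small_slice K e g s"
    unfolding small_slice_def
  proof (intro conjI ballI impI)
    show "\<exists>k\<in>K. s < blinfun_apply g k" using bd(2) d by (intro bexI[of _ k]) (auto simp: s_def)
    fix x y assume "x \<in> K" "y \<in> K" "s < blinfun_apply g x" "s < blinfun_apply g y"
    then have "norm (x - a0) \<le> e / 2" "norm (y - a0) \<le> e / 2" using near by auto
    then show "dist x y \<le> e" using dist_triangle2[of x y a0] by (simp add: dist_norm)
  qed
  moreover have "blinfun_apply g x \<le> s" if "x \<in> K1" for x
    using that by (intro gC) (auto simp: C_def G_def intro: hull_inc)
  ultimately show ?thesis by (rule that)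
qed

text \<open>
  Take the minimal set \<open>E\<close> on which the maxima of \<open>K\<close> above \<open>D\<close> are attained, and a relatively open
  piece \<open>E \<inter> V\<close> of small diameter. The hull \<open>K0\<close> of that piece is small, and the hull \<open>K1\<close> of
  \<open>E - V\<close> and \<open>D\<close> misses a part of \<open>K\<close> by minimality of \<open>E\<close>, while \<open>K\<close> is contained in the closed
  join of \<open>K0\<close> and \<open>K1\<close>. So the superlemma applies.
\<close>

lemma small_slice_away_from_convex:
  fixes K D :: "'a::real_normed_vector set"
  assumes K: "compactin weak_topology K" and D: "convex D" "bounded D" "D \<noteq> {}"
    and h: "k0 \<in> K" "\<And>d. d \<in> D \<Longrightarrow> blinfun_apply h d \<le> s0" "s0 < (blinfun_apply h k0 :: real)"
    and e: "e > 0"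
  obtains g s where "small_slice K e g s" "\<And>d. d \<in> D \<Longrightarrow> blinfun_apply g d \<le> s"
proof -
  define good where "good = (\<lambda>(g :: 'a \<Rightarrow>\<^sub>L real) k. k \<in> K \<and> (\<forall>x\<in>K. blinfun_apply g x \<le> blinfun_apply g k) \<and>
      (\<exists>s<blinfun_apply g k. \<forall>d\<in>D. blinfun_apply g d \<le> s))"
  obtain U where U: "openin weak_topology U"
    "\<And>g k. good g k \<Longrightarrow> \<exists>x\<in>K - U. blinfun_apply g x = blinfun_apply g k"
    "\<And>V. openin weak_topology V \<Longrightarrow> (K - U) \<inter> V \<noteq> {} \<Longrightarrow>
       \<exists>g k. good g k \<and> (\<forall>x\<in>K - U - V. blinfun_apply g x < blinfun_apply g k)"
    using minimal_attaining_set[OF K, of D] unfolding good_def by blast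
  have attain: "\<exists>x\<in>K - U. s < blinfun_apply g x"
    if "x \<in> K" "s < blinfun_apply g x" "\<And>d. d \<in> D \<Longrightarrow> blinfun_apply g d \<le> s" for x s and g :: "'a \<Rightarrow>\<^sub>L real"
  proof -
    have "K \<noteq> {}" using that(1) by auto
    obtain k where k: "k \<in> K" "\<And>y. y \<in> K \<Longrightarrow> blinfun_apply g y \<le> blinfun_apply g k"
      using weakly_compact_attains_sup[OF K \<open>K \<noteq> {}\<close>, of g] by metis
    have sk: "s < blinfun_apply g k" using k(2)[OF that(1)] that(2) by linarith
    then have "good g k" using k that(3) unfolding good_def by blast
    from U(2)[OF this] obtain y where "y \<in> K - U" "blinfun_apply g y = blinfun_apply g k" ..
    with sk show ?thesis by (intro bexI[of _ y]) simp_all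
  qed
  define E where "E = K - U"
  have EU: "E = (UNIV - U) \<inter> K" by (auto simp: E_def)
  have Ecomp: "compactin weak_topology E"
    unfolding EU using U(1) K by (intro closed_Int_compactin) (auto simp: closedin_def double_diff)
  have "E \<noteq> {}" using attain[OF h(1,3,2)] by (auto simp: E_def)
  have e4: "e / 4 > 0" using e by simp
  obtain V where V: "openin weak_topology V" "E \<inter> V \<noteq> {}"
    "\<forall>x\<in>E \<inter> V. \<forall>y\<in>E \<inter> V. dist x y \<le> e / 4"
    by (rule weakly_compact_fragmented[OF Ecomp \<open>E \<noteq> {}\<close> e4])
  obtain a0 where a0: "a0 \<in> E \<inter> V" using V(2) by blast
  from U(3)[OF V(1)] V(2) obtain g1 k where gk: "good g1 k" "\<And>x. x \<in> E - V \<Longrightarrow> blinfun_apply g1 x < blinfun_apply g1 k"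
    unfolding E_def by blast
  from gk(1) have k: "k \<in> K" "\<And>x. x \<in> K \<Longrightarrow> blinfun_apply g1 x \<le> blinfun_apply g1 k" by (auto simp: good_def)
  from gk(1) obtain sD where sD: "sD < blinfun_apply g1 k" "\<And>d. d \<in> D \<Longrightarrow> blinfun_apply g1 d \<le> sD"
    by (auto simp: good_def)
  have "\<exists>s1<blinfun_apply g1 k. \<forall>x\<in>(E - V) \<union> D. blinfun_apply g1 x \<le> s1"
  proof (cases "E - V = {}")
    case True
    then show ?thesis using sD by auto
  next
    case False
    have EV: "E - V = (UNIV - V) \<inter> E" by auto
    have "compactin weak_topology (E - V)"
      unfolding EV using V(1) Ecomp by (intro closed_Int_compactin) (auto simp: closedin_def double_diff)
    then obtain x1 where x1: "x1 \<in> E - V" "\<And>y. y \<in> E - V \<Longrightarrow> blinfun_apply g1 y \<le> blinfun_apply g1 x1"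
      using weakly_compact_attains_sup[of "E - V" g1] False by metis
    show ?thesis
      using x1 sD gk(2)[OF x1(1)] by (intro exI[of _ "max sD (blinfun_apply g1 x1)"]) (auto simp: le_max_iff_disj)
  qed
  then obtain s1 where s1: "s1 < blinfun_apply g1 k" "\<And>x. x \<in> (E - V) \<union> D \<Longrightarrow> blinfun_apply g1 x \<le> s1" by blast
  define K0 where "K0 = convex hull (E \<inter> V)"
  define K1 where "K1 = convex hull ((E - V) \<union> D)"
  define Z where "Z = {(1 - l) *\<^sub>R a + l *\<^sub>R b | l a b. 0 \<le> l \<and> l \<le> 1 \<and> a \<in> K0 \<and> b \<in> K1}"
  have sub: "E \<inter> V \<subseteq> K0" "E - V \<subseteq> K1" "D \<subseteq> K1" by (auto simp: K0_def K1_def hull_inc)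
  have a0K: "a0 \<in> K0" using sub a0 by blast
  have ne: "K0 \<noteq> {}" "K1 \<noteq> {}" using a0K sub(3) D(3) by auto
  obtain b0 where b0: "b0 \<in> K1" using ne by blast
  have KZ0: "K0 \<subseteq> Z"
  proof
    fix x assume "x \<in> K0"
    then show "x \<in> Z" unfolding Z_def using b0 by (intro CollectI exI[of _ 0] exI[of _ x] exI[of _ b0]) auto
  qed
  have KZ1: "K1 \<subseteq> Z"
  proof
    fix x assume "x \<in> K1"
    then show "x \<in> Z" unfolding Z_def using a0K by (intro CollectI exI[of _ 1] exI[of _ a0] exI[of _ x]) auto
  qed
  have Zc: "convex Z" unfolding Z_def by (rule convex_join) (auto simp: K0_def K1_def)
  \<comment> \<open>A point of \<open>K\<close> outside the closure would be separated from \<open>Z\<close>, thus from \<open>D\<close>; the maximum of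
    the separating functional over \<open>K\<close> is then attained on \<open>E\<close>, but \<open>E\<close> is contained in \<open>Z\<close>.\<close>
  have join: "K \<subseteq> closure Z"
  proof
    fix x assume x: "x \<in> K"
    show "x \<in> closure Z"
    proof (rule weak_limit_in_closure)
      show "convex (closure Z)" using Zc by (rule convex_closure)
      show "Z \<noteq> {}" using KZ0 a0K by blast
      fix f :: "'a \<Rightarrow>\<^sub>L real" and c assume f: "\<And>q. q \<in> Z \<Longrightarrow> c \<le> blinfun_apply f q"
      show "c \<le> blinfun_apply f x"
      proof (rule ccontr)
        assume "\<not> ?thesis"
        then have "- c < blinfun_apply (- f) x" by (simp add: blinfun.minus_left)
        moreover have "blinfun_apply (- f) d \<le> - c" if "d \<in> D" for d
        proof -
          have "d \<in> Z" using that sub(3) KZ1 by blast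
          from f[OF this] show ?thesis by (simp add: blinfun.minus_left)
        qed
        ultimately obtain y where y: "y \<in> K - U" "- c < blinfun_apply (- f) y"
          using attain[OF x] by blast
        have "y \<in> Z" using y(1) sub KZ0 KZ1 unfolding E_def by blast
        from f[OF this] y(2) show False by (simp add: blinfun.minus_left)
      qed
    qed
  qed
  have "bounded K1"
    unfolding K1_def
  proof (rule bounded_convex_hull)
    have "bounded E" using Ecomp by (rule weakly_compact_imp_bounded)
    then have "bounded (E - V)" by (rule bounded_subset) auto
    then show "bounded ((E - V) \<union> D)" using D(2) by simp
  qed
  show ?thesis
  proof (rule slice_away_from_one_side_of_join[where K = K and ?K0.0 = K0 and ?K1.0 = K1 and ?a0.0 = a0 and ?r0.0 = "e / 4" and ?g1.0 = g1
        and k = k and ?s1.0 = s1 and e = e])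
    show "K0 \<subseteq> cball a0 (e / 4)"
      unfolding K0_def using V(3) a0 by (intro hull_minimal) auto
    show "K \<subseteq> closure {(1 - l) *\<^sub>R a + l *\<^sub>R b | l a b. 0 \<le> l \<and> l \<le> 1 \<and> a \<in> K0 \<and> b \<in> K1}"
      using join unfolding Z_def .
    show "blinfun_apply g1 x \<le> blinfun_apply g1 k" if "x \<in> K0" for x
      by (rule functional_le_on_convex_hull[OF _ that[unfolded K0_def]]) (auto simp: E_def intro: k(2))
    show "blinfun_apply g1 x \<le> s1" if "x \<in> K1" for x
      by (rule functional_le_on_convex_hull[OF s1(2) that[unfolded K1_def]])
    fix g s assume gs: "small_slice K e g s" "\<And>x. x \<in> K1 \<Longrightarrow> blinfun_apply g x \<le> s"
    then show thesis using sub(3) by (intro that[of g s]) auto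
  qed (use ne \<open>bounded K1\<close> k(1) s1(1) e in auto)
qed

section \<open>Strongly exposed points\<close>

text \<open>
  Consider the graph of \<open>f\<close> over \<open>K\<close> in the product with the real line, and below it the flat disc
  \<open>D\<close> of radius \<open>M\<close> at height \<open>b\<close>. A functional \<open>(u, t) \<mapsto> h u + c t\<close> that is larger at some point of
  the graph than on \<open>D\<close> must have \<open>c > 0\<close> and \<open>h / c\<close> of norm at most \<open>C / (M - R)\<close>, where \<open>C\<close>
  bounds the height of the graph above \<open>D\<close> and \<open>R\<close> the norm on \<open>K\<close>. On the graph it agrees with
  \<open>c\<close> times the perturbation \<open>f + h / c\<close> of \<open>f\<close>.
\<close>

lemma small_slice_dense:
  fixes K :: "'a::real_normed_vector set" and f :: "'a \<Rightarrow>\<^sub>L real"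
  assumes K: "compactin weak_topology K" "K \<noteq> {}" and "\<eta> > 0" and e: "e > 0"
  obtains g s where "norm (g - f) < \<eta>" "small_slice K e g s"
proof -
  obtain R where R: "R > 0" "\<And>x. x \<in> K \<Longrightarrow> norm x \<le> R"
    using weakly_compact_imp_bounded[OF K(1)] unfolding bounded_pos by blast
  define b where "b = - norm f * R - 1"
  define C where "C = 2 * norm f * R + 1"
  define M where "M = R + 2 * C / \<eta>"
  have C: "C > 0" using R(1) by (auto simp: C_def intro: add_nonneg_pos)
  have M: "M > R" using C \<open>\<eta> > 0\<close> by (simp add: M_def)
  have fK: "0 < blinfun_apply f x - b" "blinfun_apply f x - b \<le> C" if "x \<in> K" for x
  proof -
    have "\<bar>blinfun_apply f x\<bar> \<le> norm f * norm x" using norm_blinfun[of f x] by simp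
    also have "\<dots> \<le> norm f * R" using R(2)[OF that] by (intro mult_left_mono) auto
    finally show "0 < blinfun_apply f x - b" "blinfun_apply f x - b \<le> C"
      unfolding b_def C_def by linarith+
  qed
  define T where "T x = (x, blinfun_apply f x)" for x
  have T: "bounded_linear T"
    unfolding T_def by (intro bounded_linear_Pair bounded_linear_ident blinfun.bounded_linear_right)
  have TK: "compactin weak_topology (T ` K)"
    by (rule image_compactin[OF K(1) continuous_map_weak_linear[OF T]])
  obtain k0 where k0: "k0 \<in> K" using K(2) by blast
  define D where "D = cball (0::'a) M \<times> {b}"
  have D: "convex D" "bounded D" "D \<noteq> {}"
    using M R(1) by (auto simp: D_def intro!: convex_Times bounded_Times)
  have snd: "blinfun_apply (Blinfun snd) p = (snd p :: real)" for p :: "'a \<times> real"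
    by (simp add: bounded_linear_Blinfun_apply bounded_linear_snd)
  obtain G s where G: "small_slice (T ` K) e G s" "\<And>d. d \<in> D \<Longrightarrow> blinfun_apply G d \<le> s"
  proof (rule small_slice_away_from_convex[OF TK D, where h = "Blinfun snd" and ?k0.0 = "T k0" and ?s0.0 = b])
    show "b < blinfun_apply (Blinfun snd) (T k0)" using fK(1)[OF k0] by (simp add: snd T_def)
    show "blinfun_apply (Blinfun snd) d \<le> b" if "d \<in> D" for d using that by (auto simp: snd D_def)
  qed (use k0 e in auto)
  define h where "h = Blinfun (\<lambda>u. blinfun_apply G (u, 0))"
  define c where "c = blinfun_apply G (0, 1)"
  have h: "blinfun_apply h u = blinfun_apply G (u, 0)" for u
    unfolding h_def
    by (rule bounded_linear_Blinfun_apply[THEN fun_cong])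
       (intro bounded_linear_compose[OF blinfun.bounded_linear_right, unfolded o_def]
          bounded_linear_Pair bounded_linear_ident bounded_linear_zero)
  have split: "blinfun_apply G (u, t) = blinfun_apply h u + t * c" for u t
  proof -
    have "(u, t) = (u, 0) + t *\<^sub>R (0, 1)" by simp
    then have "blinfun_apply G (u, t) = blinfun_apply G (u, 0) + t *\<^sub>R blinfun_apply G (0, 1)"
      by (metis blinfun.add_right blinfun.scaleR_right)
    then show ?thesis by (simp add: h c_def)
  qed
  obtain k where k: "k \<in> K" "s < blinfun_apply G (T k)" using G(1) by (auto simp: small_slice_def)
  have sep: "blinfun_apply h u < c * (blinfun_apply f k - b)" if "norm u \<le> M - R" for u
  proof -
    have "norm (k + u) \<le> M" using norm_triangle_ineq[of k u] R(2)[OF k(1)] that by linarith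
    then have "(k + u, b) \<in> D" by (auto simp: D_def)
    from G(2)[OF this] k(2) show ?thesis
      by (simp add: T_def split blinfun.add_right algebra_simps)
  qed
  have "0 < c * (blinfun_apply f k - b)" using sep[of 0] M by (simp add: blinfun.zero_right)
  then have c: "c > 0" using fK(1)[OF k(1)] by (simp add: zero_less_mult_iff)
  have small: "\<bar>blinfun_apply h u\<bar> \<le> c * C" if "norm u \<le> M - R" for u
  proof -
    have "c * (blinfun_apply f k - b) \<le> c * C" using fK(2)[OF k(1)] c by (intro mult_left_mono) auto
    then show ?thesis using sep[OF that] sep[of "- u"] that by (simp add: blinfun.minus_right)
  qed
  have hn: "norm h \<le> c * C / (M - R)"
  proof (rule norm_blinfun_bound)
    show "0 \<le> c * C / (M - R)" using c C M by simp
    fix x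
    show "norm (blinfun_apply h x) \<le> c * C / (M - R) * norm x"
    proof (cases "x = 0")
      case True
      then show ?thesis by (simp add: blinfun.zero_right)
    next
      case False
      define u where "u = ((M - R) / norm x) *\<^sub>R x"
      have "norm u = M - R" using False M by (simp add: u_def)
      then have "\<bar>blinfun_apply h u\<bar> \<le> c * C" using small by simp
      then have "(M - R) / norm x * \<bar>blinfun_apply h x\<bar> \<le> c * C"
        using M by (simp add: u_def blinfun.scaleR_right abs_mult)
      then show ?thesis using False M by (simp add: field_simps)
    qed
  qed
  define g where "g = f + (1 / c) *\<^sub>R h"
  have "norm (g - f) = norm h / c" using c by (simp add: g_def)
  also have "\<dots> \<le> C / (M - R)" using hn c M by (simp add: field_simps)
  also have "\<dots> < \<eta>" using C \<open>\<eta> > 0\<close> by (simp add: M_def)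
  finally have 1: "norm (g - f) < \<eta>" .
  have gG: "s / c < blinfun_apply g x \<longleftrightarrow> s < blinfun_apply G (T x)" for x
    using c by (simp add: g_def T_def split blinfun.add_left blinfun.scaleR_left field_simps)
  have "small_slice K e g (s / c)"
    unfolding small_slice_def gG
  proof (intro conjI ballI impI)
    show "\<exists>k\<in>K. s < blinfun_apply G (T k)" using k by blast
    fix x y assume "x \<in> K" "y \<in> K" "s < blinfun_apply G (T x)" "s < blinfun_apply G (T y)"
    then have "dist (T x) (T y) \<le> e" using G(1) by (auto simp: small_slice_def)
    moreover have "dist x y \<le> dist (T x) (T y)" using dist_fst_le[of "T x" "T y"] by (simp add: T_def)
    ultimately show "dist x y \<le> e" by linarith
  qed
  with 1 show ?thesis by (rule that)
qed

lemma small_slice_open: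
  fixes K :: "'a::real_normed_vector set"
  assumes "bounded K"
  shows "open {f. \<exists>s. small_slice K e f s}"
  unfolding open_dist
proof (intro ballI)
  fix g assume "g \<in> {f. \<exists>s. small_slice K e f s}"
  then obtain s where s: "small_slice K e g s" by blast
  then obtain k where k: "k \<in> K" "s < blinfun_apply g k" by (auto simp: small_slice_def)
  obtain R where R: "R > 0" "\<And>x. x \<in> K \<Longrightarrow> norm x \<le> R" using assms unfolding bounded_pos by blast
  define \<gamma> where "\<gamma> = (blinfun_apply g k - s) / 3"
  have \<gamma>: "\<gamma> > 0" using k by (simp add: \<gamma>_def)
  show "\<exists>d>0. \<forall>f. dist f g < d \<longrightarrow> f \<in> {f. \<exists>s. small_slice K e f s}"
  proof (intro exI[of _ "\<gamma> / R"] conjI allI impI)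
    show "\<gamma> / R > 0" using \<gamma> R by simp
    fix f assume f: "dist f g < \<gamma> / R"
    have near: "\<bar>blinfun_apply f x - blinfun_apply g x\<bar> \<le> \<gamma>" if "x \<in> K" for x
    proof -
      have "\<bar>blinfun_apply (f - g) x\<bar> \<le> norm (f - g) * norm x" using norm_blinfun[of "f - g" x] by simp
      also have "\<dots> \<le> (\<gamma> / R) * R"
        using f R(2)[OF that] R(1) \<gamma> by (intro mult_mono) (auto simp: dist_norm)
      finally show ?thesis using R(1) by (simp add: blinfun.diff_left)
    qed
    have "small_slice K e f (s + \<gamma>)"
      unfolding small_slice_def
    proof (intro conjI ballI impI)
      show "\<exists>k\<in>K. s + \<gamma> < blinfun_apply f k"
      proof (rule bexI[OF _ k(1)])
        have "blinfun_apply g k = s + 3 * \<gamma>" by (simp add: \<gamma>_def field_simps)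
        then show "s + \<gamma> < blinfun_apply f k" using near[OF k(1)] \<gamma> by linarith
      qed
      fix x y assume xy: "x \<in> K" "y \<in> K" "s + \<gamma> < blinfun_apply f x" "s + \<gamma> < blinfun_apply f y"
      then have "s < blinfun_apply g x" "s < blinfun_apply g y" using near[of x] near[of y] by auto
      then show "dist x y \<le> e" using s xy by (auto simp: small_slice_def)
    qed
    then show "f \<in> {f. \<exists>s. small_slice K e f s}" by blast
  qed
qed

text \<open>
  Baire's theorem gives one functional with slices of arbitrarily small diameter. Each of these
  slices contains every point at which the functional is maximal, so they shrink to a single point.
\<close>

lemma strongly_exposed_point_exists:
  fixes K :: "'a::real_normed_vector set"
  assumes K: "compactin weak_topology K" "K \<noteq> {}"
  obtains f :: "'a \<Rightarrow>\<^sub>L real" and x0 where "x0 \<in> K" "\<And>x. x \<in> K \<Longrightarrow> blinfun_apply f x \<le> blinfun_apply f x0"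
    "\<And>e. e > 0 \<Longrightarrow> \<exists>d>0. \<forall>x\<in>K. blinfun_apply f x0 - d < blinfun_apply f x \<longrightarrow> dist x x0 \<le> e"
proof -
  define T where "T n = {f. \<exists>s. small_slice K (1 / real (Suc n)) f s}" for n
  have "open (T n)" for n
    unfolding T_def by (intro small_slice_open weakly_compact_imp_bounded K)
  moreover have "closure (T n) = UNIV" for n
  proof (intro set_eqI iffI UNIV_I)
    fix f :: "'a \<Rightarrow>\<^sub>L real"
    show "f \<in> closure (T n)"
      unfolding closure_approachable
    proof (intro allI impI)
      fix \<eta> :: real assume "\<eta> > 0"
      then obtain g s where "norm (g - f) < \<eta>" "small_slice K (1 / real (Suc n)) g s"
        using small_slice_dense[OF K, of \<eta> "1 / real (Suc n)" f] by auto
      then show "\<exists>g\<in>T n. dist g f < \<eta>" by (auto simp: T_def dist_norm)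
    qed
  qed
  ultimately have "euclidean closure_of \<Inter> (range T) = topspace euclidean"
    by (intro Baire_category disjI1 completely_metrizable_space_euclidean) auto
  then have "\<Inter> (range T) \<noteq> {}" by (metis closure_of_empty UNIV_not_empty topspace_euclidean)
  then obtain f where f: "\<And>n. f \<in> T n" by blast
  obtain x0 where x0: "x0 \<in> K" "\<And>x. x \<in> K \<Longrightarrow> blinfun_apply f x \<le> blinfun_apply f x0"
    using weakly_compact_attains_sup[OF K, of f] by metis
  have "\<exists>d>0. \<forall>x\<in>K. blinfun_apply f x0 - d < blinfun_apply f x \<longrightarrow> dist x x0 \<le> e" if "e > 0" for e
  proof -
    from reals_Archimedean[OF that] obtain n where n: "inverse (real (Suc n)) < e" by blast
    from f[of n] obtain s where s: "small_slice K (1 / real (Suc n)) f s" by (auto simp: T_def)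
    then obtain k where k: "k \<in> K" "s < blinfun_apply f k" by (auto simp: small_slice_def)
    have sx: "s < blinfun_apply f x0" using x0(2)[OF k(1)] k(2) by linarith
    show ?thesis
    proof (intro exI[of _ "blinfun_apply f x0 - s"] conjI ballI impI)
      show "blinfun_apply f x0 - s > 0" using sx by simp
      fix x assume x: "x \<in> K" "blinfun_apply f x0 - (blinfun_apply f x0 - s) < blinfun_apply f x"
      then have "dist x x0 \<le> 1 / real (Suc n)" using s x0(1) sx by (auto simp: small_slice_def)
      then show "dist x x0 \<le> e" using n by (simp add: inverse_eq_divide)
    qed
  qed
  with x0 show ?thesis by (rule that)
qed

section \<open>Minkowski sums and the Hausdorff distance\<close>

lemma bounded_set_plus:
  fixes A B :: "'a::real_normed_vector set"
  assumes "bounded A" "bounded B"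
  shows "bounded (A + B)"
  unfolding set_plus_image using assms by (rule bounded_plus)

lemma bounded_set_sum:
  fixes B :: "'i \<Rightarrow> 'a::real_normed_vector set"
  assumes "\<And>i. i \<in> F \<Longrightarrow> bounded (B i)"
  shows "bounded (\<Sum>i\<in>F. B i)"
  using assms
  by (induction F rule: infinite_finite_induct) (simp_all add: set_zero bounded_set_plus)

lemma sum_in_set_sum:
  assumes "finite F" "\<And>i. i \<in> F \<Longrightarrow> x i \<in> B i"
  shows "sum x F \<in> (\<Sum>i\<in>F. B i)"
  unfolding set_sum_alt[OF assms(1)] using assms(2) by blast

lemma set_sum_singletons: "(\<Sum>i\<in>F. {x i}) = {sum x F}"
  by (induction F rule: infinite_finite_induct) (simp_all add: set_zero set_plus_def)

lemma singleton_cwk: "{y} \<in> cwk"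
  by (simp add: cwk_def finite_imp_compactin)

lemma hausdorff_dist_commute: "hausdorff_dist A B = hausdorff_dist B A"
  by (simp add: hausdorff_dist_def max.commute)

lemma hausdorff_dist_singletons [simp]: "hausdorff_dist {a} {b} = dist a b"
  by (simp add: hausdorff_dist_def dist_commute)

lemma hausdorff_dist_approx:
  assumes A: "bounded A" "a \<in> A" and B: "B \<noteq> {}" and r: "hausdorff_dist A B < r"
  shows "\<exists>b\<in>B. dist a b < r"
proof -
  obtain b0 where b0: "b0 \<in> B" using B by blast
  obtain M where M: "\<And>x. x \<in> A \<Longrightarrow> dist b0 x \<le> M" using A(1) bounded_any_center[of A b0] by blast
  have "bdd_above ((\<lambda>a. infdist a B) ` A)"
  proof (rule bdd_aboveI2)
    fix x assume "x \<in> A"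
    then show "infdist x B \<le> M" using infdist_le[OF b0, of x] M[of x] by (simp add: dist_commute)
  qed
  then have "infdist a B \<le> hausdorff_dist A B"
    unfolding hausdorff_dist_def using A(2) by (intro max.coboundedI1 cSUP_upper)
  then have "(INF b\<in>B. dist a b) < r" using r B by (simp add: infdist_notempty)
  then show ?thesis using B by (subst (asm) cINF_less_iff) auto
qed

text \<open>
  The form of Radstrom's cancellation law that is needed: for a functional \<open>h\<close> norming \<open>c\<close>, the
  supremum of \<open>h\<close> over \<open>A + C\<close> exceeds that over \<open>A\<close> by at least \<open>norm c\<close>, but by at most \<open>r\<close>.
\<close>

lemma summand_small_if_sum_near:
  fixes A C :: "'a::real_normed_vector set"
  assumes A: "bounded A" "A \<noteq> {}" and near: "\<And>x. x \<in> A + C \<Longrightarrow> \<exists>a\<in>A. dist x a \<le> r" and c: "c \<in> C"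
  shows "norm c \<le> r"
proof (rule field_le_epsilon)
  fix \<tau> :: real assume \<tau>: "\<tau> > 0"
  obtain h :: "'a \<Rightarrow>\<^sub>L real" where h: "\<And>z. \<bar>blinfun_apply h z\<bar> \<le> norm z" "blinfun_apply h c = norm c"
    using norming_functional[of c] by blast
  obtain M where M: "\<And>x. x \<in> A \<Longrightarrow> norm x \<le> M" using A(1) unfolding bounded_iff by blast
  have bdd: "bdd_above (blinfun_apply h ` A)"
  proof (rule bdd_aboveI2)
    fix x assume "x \<in> A"
    then show "blinfun_apply h x \<le> M" using M[of x] h(1)[of x] by linarith
  qed
  have "(SUP x\<in>A. blinfun_apply h x) - \<tau> < (SUP x\<in>A. blinfun_apply h x)" using \<tau> by simp
  then obtain a where a: "a \<in> A" "(SUP x\<in>A. blinfun_apply h x) - \<tau> < blinfun_apply h a"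
    by (subst (asm) less_cSUP_iff[OF A(2) bdd]) auto
  obtain b where b: "b \<in> A" "dist (a + c) b \<le> r" using near a(1) c by blast
  have "blinfun_apply h b \<le> (SUP x\<in>A. blinfun_apply h x)" using b(1) bdd by (rule cSUP_upper)
  moreover have "\<bar>blinfun_apply h (a + c - b)\<bar> \<le> r" using h(1)[of "a + c - b"] b(2) by (simp add: dist_norm)
  ultimately show "norm c \<le> r + \<tau>"
    using a(2) h(2) by (simp add: blinfun.add_right blinfun.diff_right)
qed

lemma has_set_sum_approx:
  assumes "has_set_sum B S I" "r > 0"
  shows "eventually (\<lambda>F. hausdorff_dist (\<Sum>i\<in>F. B i) S < r) (finite_subsets_at_top I)"
  using assms order_tendstoD(2)[of "\<lambda>F. hausdorff_dist (\<Sum>i\<in>F. B i) S" 0] by (simp add: has_set_sum_def)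

lemma cwk_bounded: "K \<in> cwk \<Longrightarrow> bounded K"
  by (simp add: cwk_def weakly_compact_imp_bounded)

section \<open>Unconditional sums of selections\<close>

lemma summable_on_Cauchy_criterion:
  fixes x :: "'i \<Rightarrow> 'a::banach"
  assumes "\<And>\<epsilon>. \<epsilon> > 0 \<Longrightarrow> \<exists>F0. finite F0 \<and> F0 \<subseteq> I \<and> (\<forall>G. finite G \<and> G \<subseteq> I - F0 \<longrightarrow> norm (sum x G) \<le> \<epsilon>)"
  shows "x summable_on I"
proof -
  have "\<exists>P. eventually P (finite_subsets_at_top I) \<and> (\<forall>F F'. P F \<and> P F' \<longrightarrow> dist (sum x F) (sum x F') < e)"
    if "e > 0" for e
  proof -
    have "e / 3 > 0" using that by simp
    from assms[OF this] obtain F0 where F0: "finite F0" "F0 \<subseteq> I"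
      "\<forall>G. finite G \<and> G \<subseteq> I - F0 \<longrightarrow> norm (sum x G) \<le> e / 3" by blast
    have near: "norm (sum x F - sum x F0) \<le> e / 3" if "finite F" "F0 \<subseteq> F" "F \<subseteq> I" for F
    proof -
      have "sum x F - sum x F0 = sum x (F - F0)" using that by (simp add: sum_diff)
      then show ?thesis using F0(3)[rule_format, of "F - F0"] that by auto
    qed
    show ?thesis
    proof (intro exI[of _ "\<lambda>F. finite F \<and> F0 \<subseteq> F \<and> F \<subseteq> I"] conjI allI impI)
      show "eventually (\<lambda>F. finite F \<and> F0 \<subseteq> F \<and> F \<subseteq> I) (finite_subsets_at_top I)"
        unfolding eventually_finite_subsets_at_top using F0(1,2) by blast
      fix F F' assume F: "(finite F \<and> F0 \<subseteq> F \<and> F \<subseteq> I) \<and> finite F' \<and> F0 \<subseteq> F' \<and> F' \<subseteq> I"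
      have "dist (sum x F) (sum x F') \<le> norm (sum x F - sum x F0) + norm (sum x F' - sum x F0)"
        using dist_triangle2[of "sum x F" "sum x F'" "sum x F0"] by (simp add: dist_norm)
      also have "\<dots> \<le> e / 3 + e / 3" using F by (intro add_mono near) auto
      finally show "dist (sum x F) (sum x F') < e" using that by simp
    qed
  qed
  then have "cauchy_filter (filtermap (sum x) (finite_subsets_at_top I))"
    by (simp add: cauchy_filter_metric_filtermap)
  moreover have "complete (UNIV::'a set)"
    by (rule complete_UNIV)
  ultimately obtain L where "(sum x \<longlongrightarrow> L) (finite_subsets_at_top I)"
    using complete_uniform[where S=UNIV] by (force simp add: filterlim_def)
  then show ?thesis
    by (auto simp: summable_on_def has_sum_def)
qed

text \<open>
  The set sums over \<open>F0\<close> and over \<open>F0 \<union> G\<close> are both close to \<open>S\<close>, hence to one another;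
  cancelling the sum over \<open>F0\<close> shows that all elements of the sum over \<open>G\<close> are small.
\<close>

lemma selection_of_set_sum_summable:
  fixes x :: "'i \<Rightarrow> 'a::banach"
  assumes sum: "has_set_sum B S I" and bd: "\<And>i. i \<in> I \<Longrightarrow> bounded (B i)"
    and x: "\<And>i. i \<in> I \<Longrightarrow> x i \<in> B i"
  shows "x summable_on I"
proof (rule summable_on_Cauchy_criterion)
  fix \<epsilon> :: real assume "\<epsilon> > 0"
  then have "\<epsilon> / 2 > 0" by simp
  from has_set_sum_approx[OF sum this] obtain F0 where F0: "finite F0" "F0 \<subseteq> I"
    "\<forall>F. finite F \<and> F0 \<subseteq> F \<and> F \<subseteq> I \<longrightarrow> hausdorff_dist (\<Sum>i\<in>F. B i) S < \<epsilon> / 2"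
    unfolding eventually_finite_subsets_at_top by blast
  have S: "S \<noteq> {}" "bounded S" using sum cwk_bounded by (auto simp: has_set_sum_def cwk_def)
  have "norm (sum x G) \<le> \<epsilon>" if G: "finite G" "G \<subseteq> I - F0" for G
  proof (rule summand_small_if_sum_near)
    show "bounded (\<Sum>i\<in>F0. B i)" using bd F0(2) by (intro bounded_set_sum) auto
    have mem: "sum x F0 \<in> (\<Sum>i\<in>F0. B i)" using x F0 by (intro sum_in_set_sum) auto
    then show ne: "(\<Sum>i\<in>F0. B i) \<noteq> {}" by auto
    show "sum x G \<in> (\<Sum>i\<in>G. B i)" using x G by (intro sum_in_set_sum) auto
    fix p assume "p \<in> (\<Sum>i\<in>F0. B i) + (\<Sum>i\<in>G. B i)"
    moreover have "(\<Sum>i\<in>F0 \<union> G. B i) = (\<Sum>i\<in>F0. B i) + (\<Sum>i\<in>G. B i)"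
      using F0(1) G by (intro sum.union_disjoint) auto
    ultimately have p: "p \<in> (\<Sum>i\<in>F0 \<union> G. B i)" by simp
    have "hausdorff_dist (\<Sum>i\<in>F0 \<union> G. B i) S < \<epsilon> / 2" using F0(1,2) G by (intro F0(3)[rule_format]) auto
    moreover have "bounded (\<Sum>i\<in>F0 \<union> G. B i)" using bd F0(2) G(2) by (intro bounded_set_sum) auto
    ultimately obtain s where s: "s \<in> S" "dist p s < \<epsilon> / 2"
      using hausdorff_dist_approx[OF _ p S(1)] by blast
    have "hausdorff_dist S (\<Sum>i\<in>F0. B i) < \<epsilon> / 2"
      using F0(3)[rule_format, of F0] F0(1,2) by (simp add: hausdorff_dist_commute)
    then obtain q where q: "q \<in> (\<Sum>i\<in>F0. B i)" "dist s q < \<epsilon> / 2"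
      using hausdorff_dist_approx[OF S(2) s(1) ne] by blast
    show "\<exists>q\<in>\<Sum>i\<in>F0. B i. dist p q \<le> \<epsilon>"
      using q s dist_triangle[of p q s] by (intro bexI[of _ q]) auto
  qed
  then show "\<exists>F0. finite F0 \<and> F0 \<subseteq> I \<and> (\<forall>G. finite G \<and> G \<subseteq> I - F0 \<longrightarrow> norm (sum x G) \<le> \<epsilon>)"
    using F0(1,2) by blast
qed

lemma finite_partial_sum_approx:
  assumes sum: "has_set_sum B S I" and y: "(x has_sum y) I" and "\<tau> > 0"
  obtains F where "finite F" "F \<subseteq> I" "hausdorff_dist (\<Sum>i\<in>F. B i) S < \<tau>" "dist (sum x F) y < \<tau>"
proof -
  have "eventually (\<lambda>F. dist (sum x F) y < \<tau>) (finite_subsets_at_top I)"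
    using y \<open>\<tau> > 0\<close> by (simp add: has_sum_def tendstoD)
  with has_set_sum_approx[OF sum \<open>\<tau> > 0\<close>]
  have "eventually (\<lambda>F. hausdorff_dist (\<Sum>i\<in>F. B i) S < \<tau> \<and> dist (sum x F) y < \<tau>) (finite_subsets_at_top I)"
    by (rule eventually_conj)
  then obtain F where "finite F" "F \<subseteq> I" "hausdorff_dist (\<Sum>i\<in>F. B i) S < \<tau> \<and> dist (sum x F) y < \<tau>"
    unfolding eventually_finite_subsets_at_top by blast
  then show ?thesis using that by blast
qed

lemma selection_sum_near_set_sum:
  assumes sum: "has_set_sum B S I" and bd: "\<And>i. i \<in> I \<Longrightarrow> bounded (B i)"
    and x: "\<And>i. i \<in> I \<Longrightarrow> x i \<in> B i" and y: "(x has_sum y) I" and "r > 0"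
  shows "\<exists>s\<in>S. dist y s < r"
proof -
  have "r / 2 > 0" using \<open>r > 0\<close> by simp
  obtain F where F: "finite F" "F \<subseteq> I" "hausdorff_dist (\<Sum>i\<in>F. B i) S < r / 2" "dist (sum x F) y < r / 2"
    by (rule finite_partial_sum_approx[OF sum y \<open>r / 2 > 0\<close>])
  have S: "S \<noteq> {}" using sum by (auto simp: has_set_sum_def cwk_def)
  have "bounded (\<Sum>i\<in>F. B i)" "sum x F \<in> (\<Sum>i\<in>F. B i)"
    using bd x F by (auto intro!: bounded_set_sum sum_in_set_sum)
  from hausdorff_dist_approx[OF this S F(3)] obtain s where "s \<in> S" "dist (sum x F) s < r / 2" ..
  then show ?thesis using F(4) dist_triangle3[of y s "sum x F"] by (intro bexI[of _ s]) auto
qed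

text \<open>
  The inequality holds for the finite partial sums by linearity, and passes to the limit because
  each point of \<open>S\<close> is approximated by points of the finite set sums.
\<close>

lemma maximizing_selection_sum_maximal:
  assumes sum: "has_set_sum B S I" and ne: "\<And>i. i \<in> I \<Longrightarrow> B i \<noteq> {}"
    and x: "\<And>i b. i \<in> I \<Longrightarrow> b \<in> B i \<Longrightarrow> blinfun_apply f b \<le> (blinfun_apply f (x i) :: real)"
    and y: "(x has_sum y) I" and s: "s \<in> S"
  shows "blinfun_apply f s \<le> blinfun_apply f y"
proof (rule field_le_epsilon)
  fix \<epsilon> :: real assume \<epsilon>: "\<epsilon> > 0"
  define \<tau> where "\<tau> = \<epsilon> / (2 * (norm f + 1))"
  have \<tau>: "\<tau> > 0" using \<epsilon> by (simp add: \<tau>_def add_nonneg_pos)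
  obtain F where F: "finite F" "F \<subseteq> I" "hausdorff_dist (\<Sum>i\<in>F. B i) S < \<tau>" "dist (sum x F) y < \<tau>"
    by (rule finite_partial_sum_approx[OF sum y \<tau>])
  have S: "bounded S" using sum cwk_bounded by (auto simp: has_set_sum_def)
  have "(\<Sum>i\<in>F. B i) \<noteq> {}"
  proof -
    have "\<forall>i\<in>F. (SOME b. b \<in> B i) \<in> B i" using ne F(2) by (intro ballI some_in_eq[THEN iffD2] ne) auto
    then have "sum (\<lambda>i. SOME b. b \<in> B i) F \<in> (\<Sum>i\<in>F. B i)" using F(1) by (intro sum_in_set_sum) auto
    then show ?thesis by auto
  qed
  moreover have "hausdorff_dist S (\<Sum>i\<in>F. B i) < \<tau>" using F(3) by (simp add: hausdorff_dist_commute)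
  ultimately obtain p where p: "p \<in> (\<Sum>i\<in>F. B i)" "dist s p < \<tau>"
    using hausdorff_dist_approx[OF S s] by blast
  from p(1) obtain b where b: "p = sum b F" "\<forall>i\<in>F. b i \<in> B i"
    unfolding set_sum_alt[OF F(1)] by blast
  have "blinfun_apply f p = (\<Sum>i\<in>F. blinfun_apply f (b i))" by (simp add: b(1) blinfun.sum_right)
  also have "\<dots> \<le> (\<Sum>i\<in>F. blinfun_apply f (x i))" using b(2) F(2) x by (intro sum_mono) blast
  also have "\<dots> = blinfun_apply f (sum x F)" by (simp add: blinfun.sum_right)
  finally have 1: "blinfun_apply f p \<le> blinfun_apply f (sum x F)" .
  have lip: "blinfun_apply f u - blinfun_apply f v \<le> \<epsilon> / 2" if "dist u v < \<tau>" for u v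
  proof -
    have "blinfun_apply f u - blinfun_apply f v \<le> norm f * norm (u - v)"
      using norm_blinfun[of f "u - v"] by (simp add: blinfun.diff_right)
    also have "\<dots> \<le> (norm f + 1) * \<tau>" using that by (intro mult_mono) (auto simp: dist_norm)
    also have "\<dots> = \<epsilon> / 2"
    proof -
      have "N * (\<epsilon> / (2 * N)) = \<epsilon> / 2" if "N \<noteq> 0" for N using that by simp
      moreover have "norm f + 1 \<noteq> 0" using norm_ge_zero[of f] by linarith
      ultimately show ?thesis unfolding \<tau>_def by blast
    qed
    finally show ?thesis .
  qed
  show "blinfun_apply f s \<le> blinfun_apply f y + \<epsilon>"
    using lip[OF p(2)] lip[OF F(4)] 1 by linarith
qed

section \<open>Integrable selections\<close>

theorem theorem3p4:
  fixes \<Gamma> :: "real \<Rightarrow> 'a::banach set"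
  assumes "Birkhoff_integrable_multifunction \<Gamma>"
  shows "\<exists>g :: real \<Rightarrow> 'a. is_selection g \<Gamma> \<and> Birkhoff_integrable g"
proof -
  from assms obtain \<Phi> where \<Gamma>: "\<And>t. t \<in> {0..1} \<Longrightarrow> \<Gamma> t \<in> cwk" and \<Phi>: "\<Phi> \<in> cwk" "has_Birkhoff_integral \<Gamma> \<Phi>"
    unfolding Birkhoff_integrable_multifunction_def by blast
  have \<Phi>c: "compactin weak_topology \<Phi>" "\<Phi> \<noteq> {}" using \<Phi>(1) by (auto simp: cwk_def)
  obtain f :: "'a \<Rightarrow>\<^sub>L real" and x0 where x0: "x0 \<in> \<Phi>"
    and exposed: "\<And>e. e > 0 \<Longrightarrow> \<exists>d>0. \<forall>x\<in>\<Phi>. blinfun_apply f x0 - d < blinfun_apply f x \<longrightarrow> dist x x0 \<le> e"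
    using strongly_exposed_point_exists[OF \<Phi>c] by metis
  have "\<exists>x. x \<in> \<Gamma> t \<and> (\<forall>z\<in>\<Gamma> t. blinfun_apply f z \<le> blinfun_apply f x)" if "t \<in> {0..1}" for t
    using weakly_compact_attains_sup[of "\<Gamma> t" f] \<Gamma>[OF that] unfolding cwk_def mem_Collect_eq by metis
  then obtain g where g: "\<And>t. t \<in> {0..1} \<Longrightarrow> g t \<in> \<Gamma> t"
    "\<And>t z. t \<in> {0..1} \<Longrightarrow> z \<in> \<Gamma> t \<Longrightarrow> blinfun_apply f z \<le> blinfun_apply f (g t)"
    by metis
  have "has_Birkhoff_integral (\<lambda>t. {g t}) {x0}"
    unfolding has_Birkhoff_integral_def
  proof (intro allI impI)
    fix \<epsilon> :: real assume \<epsilon>: "\<epsilon> > 0"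
    then have "\<epsilon> / 4 > 0" by simp
    from exposed[OF this] obtain d where d: "d > 0"
      "\<And>x. x \<in> \<Phi> \<Longrightarrow> blinfun_apply f x0 - d < blinfun_apply f x \<Longrightarrow> dist x x0 \<le> \<epsilon> / 4" by blast
    \<comment> \<open>A loss of at most \<open>norm f * \<eta>\<close> occurs in each of the three steps from \<open>x0\<close> to \<open>S\<close>, from the
      sum of \<open>g\<close> to \<open>S\<close>, and from \<open>S\<close> back to \<open>\<Phi>\<close>; the total has to stay below \<open>d\<close>.\<close>
    define \<eta> where "\<eta> = min (\<epsilon> / 4) (d / (3 * (norm f + 1)))"
    have nf: "norm f + 1 > 0" by (simp add: add_nonneg_pos)
    have \<eta>: "\<eta> > 0" "\<eta> \<le> \<epsilon> / 4"
      using nf d(1) \<epsilon> unfolding \<eta>_def by (simp, intro min.cobounded1)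
    have "\<eta> \<le> d / (3 * (norm f + 1))" by (simp add: \<eta>_def)
    then have "3 * ((norm f + 1) * \<eta>) \<le> d" using nf by (simp add: pos_le_divide_eq mult_ac)
    then have \<eta>d: "3 * (norm f * \<eta>) < d" using \<eta>(1) by (simp add: algebra_simps)
    have lip: "blinfun_apply f u - blinfun_apply f v \<le> norm f * \<eta>" if "dist u v < \<eta>" for u v
    proof -
      have "blinfun_apply f u - blinfun_apply f v \<le> norm f * norm (u - v)"
        using norm_blinfun[of f "u - v"] by (simp add: blinfun.diff_right)
      also have "\<dots> \<le> norm f * \<eta>" using that by (intro mult_left_mono) (auto simp: dist_norm)
      finally show ?thesis .
    qed
    from \<Phi>(2)[unfolded has_Birkhoff_integral_def, rule_format, OF \<eta>(1)] obtain P0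
      where P0: "countable_measurable_partition P0"
      "\<forall>P. countable_measurable_partition P \<and> refines {0..1} P P0 \<longrightarrow> (\<forall>t. (\<forall>A\<in>P. t A \<in> A) \<longrightarrow>
         (\<exists>S. has_set_sum (\<lambda>A. (\<lambda>x. measure lebesgue A *\<^sub>R x) ` \<Gamma> (t A)) S P \<and> hausdorff_dist \<Phi> S < \<eta>))"
      by (elim exE conjE)
    show "\<exists>P0. countable_measurable_partition P0 \<and>
        (\<forall>P. countable_measurable_partition P \<and> refines {0..1} P P0 \<longrightarrow>
           (\<forall>t. (\<forall>A\<in>P. t A \<in> A) \<longrightarrow>
              (\<exists>S. has_set_sum (\<lambda>A. (\<lambda>x. measure lebesgue A *\<^sub>R x) ` {g (t A)}) S P \<and>
                   hausdorff_dist {x0} S < \<epsilon>)))"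
    proof (intro exI[of _ P0] conjI allI impI P0(1), elim conjE)
      fix P t assume P: "countable_measurable_partition P" "refines {0..1} P P0" and t: "\<forall>A\<in>P. t A \<in> A"
      define B where "B A = (\<lambda>x. measure lebesgue A *\<^sub>R x) ` \<Gamma> (t A)" for A
      define x where "x A = measure lebesgue A *\<^sub>R g (t A)" for A
      from P0(2)[rule_format, OF conjI, OF P bspec[OF t]] obtain S where S: "has_set_sum B S P" "hausdorff_dist \<Phi> S < \<eta>"
        unfolding B_def by blast
      have tag: "t A \<in> {0..1}" if "A \<in> P" for A
      proof -
        have "\<Union>P = {0..1}" using P(1) by (simp add: countable_measurable_partition_def partition_on_def)
        then show ?thesis using t that by blast
      qed
      have bd: "bounded (B A)" if "A \<in> P" for A
        unfolding B_def using cwk_bounded[OF \<Gamma>[OF tag[OF that]]] by (rule bounded_scaling)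
      have xB: "x A \<in> B A" if "A \<in> P" for A
        unfolding x_def B_def using g(1)[OF tag[OF that]] by (rule imageI)
      have xmax: "blinfun_apply f b \<le> blinfun_apply f (x A)" if "A \<in> P" "b \<in> B A" for A b
      proof -
        from that(2) obtain z where z: "z \<in> \<Gamma> (t A)" "b = measure lebesgue A *\<^sub>R z" by (auto simp: B_def)
        show ?thesis
          unfolding z(2) x_def blinfun.scaleR_right real_scaleR_def
          using g(2)[OF tag[OF that(1)] z(1)] by (intro mult_left_mono) auto
      qed
      have "x summable_on P" by (rule selection_of_set_sum_summable[OF S(1) bd xB])
      then obtain y where y: "(x has_sum y) P" by (auto simp: summable_on_def)
      have Sne: "S \<noteq> {}" and Sbd: "bounded S" using S(1) cwk_bounded by (auto simp: has_set_sum_def cwk_def)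
      obtain s where s: "s \<in> S" "dist y s < \<eta>"
        using selection_sum_near_set_sum[OF S(1) bd xB y \<eta>(1)] by blast
      obtain z where z: "z \<in> \<Phi>" "dist s z < \<eta>"
        using hausdorff_dist_approx[OF Sbd s(1) \<Phi>c(2)] S(2) hausdorff_dist_commute[of S \<Phi>] by metis
      obtain s0 where s0: "s0 \<in> S" "dist x0 s0 < \<eta>"
        using hausdorff_dist_approx[OF cwk_bounded[OF \<Phi>(1)] x0 Sne S(2)] by blast
      have "blinfun_apply f s0 \<le> blinfun_apply f y"
        by (rule maximizing_selection_sum_maximal[OF S(1) _ xmax y s0(1)]) (use xB in auto)
      then have "blinfun_apply f x0 - d < blinfun_apply f z"
        using lip[OF s0(2)] lip[OF s(2)] lip[OF z(2)] \<eta>d by linarith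
      then have "dist z x0 \<le> \<epsilon> / 4" by (rule d(2)[OF z(1)])
      then have "dist x0 y < \<epsilon>"
        using s(2) z(2) \<eta>(2) dist_triangle[of x0 y z] dist_triangle[of z y s] \<epsilon>
        by (simp add: dist_commute)
      moreover have "has_set_sum (\<lambda>A. {x A}) {y} P"
        unfolding has_set_sum_def set_sum_singletons hausdorff_dist_singletons
        using y singleton_cwk tendsto_dist_iff by (auto simp: has_sum_def)
      ultimately show "\<exists>S. has_set_sum (\<lambda>A. (\<lambda>x. measure lebesgue A *\<^sub>R x) ` {g (t A)}) S P \<and>
                   hausdorff_dist {x0} S < \<epsilon>"
        by (intro exI[of _ "{y}"]) (simp add: x_def)
    qed
  qed
  then show ?thesis using g(1) unfolding is_selection_def Birkhoff_integrable_def by blast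
qed

end
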